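(* Let $L=\{f_j\}$ be a leaf in $\mathbb C^n$ with center $z_L$. Suppose that there are a holomorphic function $h$ defined on a neighbourhood $V$ of $\operatorname{cl}L$ and numbers $M<\infty$, $b<1$ and $\alpha>0$ such that: (1) $|h|<M$ and $\|\nabla h\|<M$ on $V$; (2) $|h(z_L)|\le b<1$; (3) for every integer $j\ge 1$ there is an arc $\gamma_j\subset S$ of length greater than $\alpha$ such that $\liminf_{r\to1}|h(f_j(r\zeta))|\ge 1$ for all $\zeta\in\gamma_j$. Then there is a non-constant holomorphic mapping $g=(g_1,\dots,g_n):U\to\mathbb C^n$ with $g(U)\subset\operatorname{cl}L$ such that at least one of the functions $g_k$, $1\le k\le n$, covers univalently a disk in $\mathbb C$ of positive radius $r=r(M,b,\alpha)$.
   Context: $U=\{\zeta\in\mathbb C:|\zeta|<1\}$, $S=\partial U$. The dimension $n$ is fixed. A bounded holomorphic map $f:U\to\mathbb C^n$ is extended to almost every point of $S$ by its radial limits, and its holomorphic measure is the Borel measure $\mu(E,f)=\frac1{2\pi}m(f^{-1}(E)\cap S)$ on $\mathbb C^n$, $m$ being arc length on $S$. A leaf is a uniformly bounded sequence $L=\{f_j\}$ of holomorphic maps $U\to\mathbb C^n$ such that the measures $\mu(dz,f_j)$ converge weakly (against continuous functions on $\mathbb C^n$); then the points $f_j(0)$ converge to a point $z_L$, called the center of $L$. The cluster $\operatorname{cl}L$ is the set of all $z\in\mathbb C^n$ for which there are a subsequence $f_{j_k}$ and points $\zeta_{j_k}\in U$ with $\lim_{k\to\infty}f_{j_k}(\zeta_{j_k})=z$.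 A holomorphic function on $U$ covers univalently a disk $\Delta$ if it maps some subdomain of $U$ one-to-one onto $\Delta$. The notation $r=r(M,b,\alpha)$ means that the radius is a positive number determined by $M,b,\alpha$ (for the fixed $n$). *)

theory Defs
  imports "HOL-Complex_Analysis.Complex_Analysis"
begin

definition holomorphic_map :: "(complex \<Rightarrow> complex^'n) \<Rightarrow> bool" where
  "holomorphic_map f \<longleftrightarrow> (\<forall>k. (\<lambda>\<zeta>. f \<zeta> $ k) holomorphic_on ball 0 1)"

text \<open>Where the radial limit does not exist, \<open>Lim\<close> takes a fixed unspecified value. For bounded
  holomorphic maps this concerns only a null set of the circle (Fatou), so it does not affect the
  holomorphic measure.\<close>

definition radial_limit :: "(complex \<Rightarrow> complex^'n) \<Rightarrow> complex \<Rightarrow> complex^'n" where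
  "radial_limit f \<zeta> = Lim (at_left 1) (\<lambda>t. f (of_real t * \<zeta>))"

definition arc_length_measure :: "complex measure" where
  "arc_length_measure =
     distr (restrict_space lborel {0..<2*pi}) (restrict_space borel (sphere 0 1)) cis"

definition holomorphic_measure :: "(complex \<Rightarrow> complex^'n) \<Rightarrow> (complex^'n) measure" where
  "holomorphic_measure f =
     scale_measure (ennreal (1 / (2*pi))) (distr arc_length_measure borel (radial_limit f))"

definition converge_weakly :: "(nat \<Rightarrow> (complex^'n) measure) \<Rightarrow> bool" where
  "converge_weakly \<mu> \<longleftrightarrow> (\<exists>\<nu>. sets \<nu> = sets borel \<and> finite_measure \<nu> \<and>
     (\<forall>\<phi> :: complex^'n \<Rightarrow> real. continuous_on UNIV \<phi> \<longrightarrow>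
        (\<lambda>j. integral\<^sup>L (\<mu> j) \<phi>) \<longlonglongrightarrow> integral\<^sup>L \<nu> \<phi>))"

definition leaf :: "(nat \<Rightarrow> complex \<Rightarrow> complex^'n) \<Rightarrow> bool" where
  "leaf L \<longleftrightarrow>
     (\<forall>j. holomorphic_map (L j)) \<and>
     (\<exists>C. \<forall>j. \<forall>\<zeta>\<in>ball 0 1. norm (L j \<zeta>) \<le> C) \<and>
     converge_weakly (\<lambda>j. holomorphic_measure (L j))"

definition leaf_center :: "(nat \<Rightarrow> complex \<Rightarrow> complex^'n) \<Rightarrow> complex^'n" where
  "leaf_center L = lim (\<lambda>j. L j 0)"

definition leaf_cluster :: "(nat \<Rightarrow> complex \<Rightarrow> complex^'n) \<Rightarrow> (complex^'n) set" where
  "leaf_cluster L = {z. \<exists>s \<zeta>. strict_mono (s :: nat \<Rightarrow> nat) \<and> (\<forall>k. \<zeta> k \<in> ball 0 1) \<and>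
     (\<lambda>k. L (s k) (\<zeta> k)) \<longlonglongrightarrow> z}"

text \<open>Holomorphy in several variables: complex differentiability, that is, a complex-linear
  derivative \<open>v \<mapsto> c\<^sub>1 v\<^sub>1 + \<dots> + c\<^sub>n v\<^sub>n\<close>. To be used on open sets.\<close>

definition multi_holomorphic_on :: "(complex^'n \<Rightarrow> complex) \<Rightarrow> (complex^'n) set \<Rightarrow> bool" where
  "multi_holomorphic_on h V \<longleftrightarrow>
     (\<forall>z\<in>V. \<exists>c :: complex^'n. (h has_derivative (\<lambda>v. \<Sum>k\<in>UNIV. c $ k * v $ k)) (at z))"

definition complex_gradient :: "(complex^'n \<Rightarrow> complex) \<Rightarrow> complex^'n \<Rightarrow> complex^'n" where
  "complex_gradient h z = (\<chi> k. deriv (\<lambda>w. h (z + axis k w)) 0)"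

text \<open>Arcs of the unit circle of length \<open>l\<close>, each endpoint being included or not.\<close>

definition circle_arc :: "complex set \<Rightarrow> real \<Rightarrow> bool" where
  "circle_arc \<gamma> l \<longleftrightarrow> 0 < l \<and> l \<le> 2*pi \<and>
     (\<exists>a I. {a<..<a+l} \<subseteq> I \<and> I \<subseteq> {a..a+l} \<and> \<gamma> = cis ` I)"

definition covers_univalently :: "(complex \<Rightarrow> complex) \<Rightarrow> complex set \<Rightarrow> bool" where
  "covers_univalently \<phi> \<Delta> \<longleftrightarrow>
     (\<exists>D. D \<subseteq> ball 0 1 \<and> open D \<and> connected D \<and> D \<noteq> {} \<and> bij_betw \<phi> D \<Delta>)"

end

theory Submission
  imports Defs
begin

text \<open>Let \<open>\<phi>\<^sub>j = h \<circ> f\<^sub>j\<close>, which for large \<open>j\<close> is defined on the whole disc, bounded by \<open>M\<close>, and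
  nearly bounded by \<open>b < 1\<close> at the origin. If \<open>(1 - |\<zeta>|\<^sup>2) |\<phi>\<^sub>j'(\<zeta>)|\<close> were uniformly small, one could
  steer from the origin to some point of the arc \<open>\<gamma>\<^sub>j\<close> along a path on which \<open>|\<phi>\<^sub>j|\<close> stays below \<open>1\<close>:
  the values of \<open>\<phi>\<^sub>j\<close> at successively halved boundary intervals behave like a conformal martingale,
  so from a value \<open>w\<^sub>0\<close> they must be able to leave a small disc about \<open>w\<^sub>0\<close> in the direction of the
  origin, without increasing the modulus. This contradicts the radial condition, which is imposed at
  every point of the arc. So \<open>(1 - |\<zeta>\<^sub>j|\<^sup>2) |\<phi>\<^sub>j'(\<zeta>\<^sub>j)| > \<delta>(M, b, \<alpha>)\<close> for some \<open>\<zeta>\<^sub>j\<close>; composing \<open>f\<^sub>j\<close>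
  with the disc automorphism taking \<open>0\<close> to \<open>\<zeta>\<^sub>j\<close> and passing to a normal limit \<open>g\<close>, the gradient bound
  gives a component with \<open>|g\<^sub>k'(0)| \<ge> \<delta> / (M n)\<close>, and Bloch's theorem applies. That \<open>f\<^sub>j(0)\<close> converges
  rests on Fatou's theorem, by which \<open>f\<^sub>j(0)\<close> is the barycentre of the holomorphic measure.\<close>

section \<open>Univalent Bloch discs\<close>

text \<open>Landau's device: at a maximum \<open>p\<close> of \<open>(1/2 - |z|) |g'(z)|\<close> the
  derivative at most doubles on a disc about \<open>p\<close> of comparable size. Cauchy's estimate
  then makes \<open>g\<close> nearly linear on a smaller disc, so that it is injective there and
  expands distances, which forces it to cover a disc.\<close>

lemma univalent_bloch:
  assumes hol: "g holomorphic_on ball 0 1" and \<kappa>: "0 < \<kappa>" "\<kappa> \<le> cmod (deriv g 0)"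
  shows "\<exists>a. covers_univalently g (ball a (\<kappa> / 128))"
proof -
  have derg: "(g has_field_derivative deriv g z) (at z)" if "cmod z < 1" for z
    using holomorphic_derivI [OF hol, of z] that by auto
  define U where "U z = (1/2 - cmod z) * cmod (deriv g z)" for z
  have holg': "deriv g holomorphic_on ball 0 1"
    using holomorphic_deriv [OF hol] by auto
  have sub: "cball 0 (1/2) \<subseteq> ball (0::complex) 1" by auto
  have "continuous_on (cball 0 (1/2)) U"
    unfolding U_def by (intro continuous_intros holomorphic_on_imp_continuous_on holomorphic_on_subset [OF holg' sub])
  then obtain p where p: "p \<in> cball 0 (1/2)" "\<And>z. z \<in> cball 0 (1/2) \<Longrightarrow> U z \<le> U p"
    using continuous_attains_sup [of "cball (0::complex) (1/2)" U] by auto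
  have Up: "\<kappa> / 2 \<le> U p" using p(2) [of 0] \<kappa> by (simp add: U_def)
  define A where "A = deriv g p"
  define t where "t = 1/2 - cmod p"
  have "0 < U p" using Up \<kappa> by simp
  then have t: "0 < t" "0 < cmod A"
    using p(1) by (auto simp: U_def t_def A_def zero_less_mult_iff)
  \<comment> \<open>On this disc at least half of the distance \<open>t\<close> to the circle of
    radius \<open>1/2\<close> remains, so maximality of \<open>U p\<close> costs a factor of at most
    2.\<close>
  have big: "cmod (deriv g z) \<le> 2 * cmod A" if z: "z \<in> cball p (t/2)" for z
  proof -
    have nz: "cmod z \<le> cmod p + t / 2"
      using z norm_triangle_sub [of z p] by (simp add: dist_norm norm_minus_commute)
    then have *: "z \<in> cball 0 (1/2)" "t / 2 \<le> 1/2 - cmod z" using t by (auto simp: t_def field_simps)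
    then have "t / 2 * cmod (deriv g z) \<le> U z"
      unfolding U_def by (intro mult_right_mono) auto
    also have "\<dots> \<le> t * cmod A" using p(2) [OF *(1)] by (simp add: U_def t_def A_def)
    finally show ?thesis using t by (simp add: field_simps)
  qed
  have in1: "cball p (t/2) \<subseteq> ball 0 1"
  proof
    fix z assume "z \<in> cball p (t/2)"
    then have "cmod (z - p) \<le> t / 2" by (simp add: dist_norm norm_minus_commute)
    moreover have "cmod z \<le> cmod p + cmod (z - p)" by (rule norm_triangle_sub)
    moreover have "cmod p = 1/2 - t" by (simp add: t_def)
    ultimately have "cmod z < 1" using t by linarith
    then show "z \<in> ball 0 1" by simp
  qed
  have second: "cmod (deriv (deriv g) z) \<le> 8 * cmod A / t" if z: "z \<in> ball p (t/4)" for z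
  proof -
    have s: "cball z (t/4) \<subseteq> cball p (t/2)"
      using z by (simp add: cball_subset_cball_iff dist_commute)
    have "cmod ((deriv ^^ 1) (deriv g) z) \<le> fact 1 * (2 * cmod A) / (t/4) ^ 1"
    proof (rule Cauchy_inequality)
      show "deriv g holomorphic_on ball z (t/4)"
        using s in1 by (intro holomorphic_on_subset [OF holg'] order_trans [OF ball_subset_cball]) auto
      show "continuous_on (cball z (t/4)) (deriv g)"
        using s in1 by (intro holomorphic_on_imp_continuous_on holomorphic_on_subset [OF holg']) auto
      show "cmod (deriv g x) \<le> 2 * cmod A" if "cmod (z - x) = t/4" for x
        using that s by (intro big) (auto simp: subset_eq dist_norm)
    qed (use t in auto)
    then show ?thesis by simp
  qed
  \<comment> \<open>With radius \<open>t/16\<close> the bound \<open>8 |A| / t\<close> on the second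
    derivative lets \<open>deriv g\<close> deviate from \<open>A\<close> by at most
    \<open>|A|/2\<close>.\<close>
  define B where "B = ball p (t/16)"
  have Bsub: "B \<subseteq> ball p (t/4)" "B \<subseteq> ball 0 1"
  proof -
    show "B \<subseteq> ball p (t/4)" unfolding B_def using t by (intro subset_ball) simp
    have "B \<subseteq> cball p (t/2)"
      unfolding B_def using t by (intro order_trans [OF ball_subset_cball subset_cball]) simp
    then show "B \<subseteq> ball 0 1" using in1 by simp
  qed
  have convB: "convex B" by (simp add: B_def)
  have close: "cmod (deriv g z - A) \<le> cmod A / 2" if "z \<in> B" for z
  proof -
    have "cmod (deriv g z - deriv g p) \<le> 8 * cmod A / t * cmod (z - p)"
    proof (rule field_differentiable_bound [OF convB])
      fix w assume w: "w \<in> B"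
      show "(deriv g has_field_derivative deriv (deriv g) w) (at w within B)"
        by (rule has_field_derivative_at_within, rule holomorphic_derivI [OF holg']) (use w Bsub in auto)
      show "cmod (deriv (deriv g) w) \<le> 8 * cmod A / t" using w Bsub by (intro second) auto
    qed (use that t in \<open>auto simp: B_def\<close>)
    also have "\<dots> \<le> 8 * cmod A / t * (t / 16)"
      using that t by (intro mult_left_mono) (auto simp: B_def dist_norm norm_minus_commute)
    finally show ?thesis using t by (simp add: A_def)
  qed
  have lin: "cmod ((g z - g w) - A * (z - w)) \<le> cmod A / 2 * cmod (z - w)" if "z \<in> B" "w \<in> B" for z w
  proof -
    have "cmod ((g z - A * z) - (g w - A * w)) \<le> cmod A / 2 * cmod (z - w)"
    proof (rule field_differentiable_bound [OF convB])
      fix x assume x: "x \<in> B"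
      then have "cmod x < 1" using Bsub by auto
      then show "((\<lambda>z. g z - A * z) has_field_derivative (deriv g x - A)) (at x within B)"
        by (intro has_field_derivative_at_within [OF DERIV_diff [OF derg]]) (auto intro!: derivative_eq_intros)
      show "cmod (deriv g x - A) \<le> cmod A / 2" by (rule close [OF x])
    qed (use that in auto)
    then show ?thesis by (simp add: algebra_simps)
  qed
  have expand: "cmod A / 2 * cmod (z - w) \<le> cmod (g z - g w)" if "z \<in> B" "w \<in> B" for z w
    using lin [OF that] norm_triangle_ineq3 [of "g z - g w" "A * (z - w)"] by (simp add: norm_mult)
  have inj: "inj_on g B"
  proof (rule inj_onI)
    fix z w assume "z \<in> B" "w \<in> B" "g z = g w"
    then show "z = w" using expand [of z w] t by (simp add: mult_le_0_iff)
  qed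
  \<comment> \<open>On the circle of radius \<open>s = t/32\<close> about \<open>p\<close> the
    expansion factor \<open>|A|/2\<close> gives \<open>|A| t / 64 = U p / 64\<close>. Together with
    \<open>U p \<ge> \<kappa>/2\<close> this is where 128 comes from.\<close>
  define r where "r = cmod A * t / 64"
  have "cmod A * t = U p" by (simp add: U_def t_def A_def)
  then have r: "\<kappa> / 128 \<le> r" using Up by (simp add: r_def)
  define s where "s = t / 32"
  have sB: "cball p s \<subseteq> B" using t by (simp add: s_def B_def cball_subset_ball_iff)
  have contB: "continuous_on B g"
    by (intro holomorphic_on_imp_continuous_on holomorphic_on_subset [OF hol] Bsub)
  have cover: "ball (g p) r \<subseteq> g ` ball p s"
  proof (rule ball_subset_open_map_image)
    show "continuous_on (closure (ball p s)) g"
      using sB t by (intro continuous_on_subset [OF contB]) (auto simp: s_def)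
    have "open (g ` ball p s)"
    proof (rule open_mapping_thm3)
      show "g holomorphic_on ball p s"
        using sB Bsub by (intro holomorphic_on_subset [OF hol] order_trans [OF ball_subset_cball]) auto
      show "inj_on g (ball p s)" using sB by (intro inj_on_subset [OF inj]) auto
    qed auto
    then show "open (g ` interior (ball p s))" by simp
    show "r \<le> cmod (g z - g p)" if "z \<in> frontier (ball p s)" for z
    proof -
      have z: "cmod (z - p) = s" using that t by (simp add: s_def dist_norm norm_minus_commute)
      then have "z \<in> B" "p \<in> B" using sB t by (auto simp: subset_eq dist_norm norm_minus_commute s_def B_def)
      then show ?thesis using expand [of z p] z by (simp add: r_def s_def)
    qed
    show "0 < r" using t by (simp add: r_def)
  qed (use t in \<open>auto simp: s_def\<close>)
  define \<Delta> where "\<Delta> = ball (g p) (\<kappa> / 128)"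
  define D where "D = ball p s \<inter> g -` \<Delta>"
  have DB: "D \<subseteq> B" using sB by (auto simp: D_def subset_eq)
  have "\<Delta> \<subseteq> ball (g p) r" unfolding \<Delta>_def by (rule subset_ball [OF r])
  then have img: "g ` D = \<Delta>"
    using cover by (auto simp: D_def)
  have injD: "inj_on g D" using inj DB by (rule inj_on_subset)
  have "open D"
    unfolding D_def
  proof (rule continuous_open_preimage)
    show "continuous_on (ball p s) g" using sB by (intro continuous_on_subset [OF contB]) auto
  qed (auto simp: \<Delta>_def)
  \<comment> \<open>\<open>D\<close> is a preimage and need not be a disc. It is connected as the
    image of a disc under the inverse of \<open>g\<close>, which is Lipschitz because
    \<open>g\<close> expands.\<close>
  moreover have "connected D"
  proof -
    define h where "h = the_inv_into D g"
    have h: "h y \<in> D" "g (h y) = y" if "y \<in> \<Delta>" for y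
      using that the_inv_into_into [OF injD, of y D] f_the_inv_into_f [OF injD, of y] img
      by (auto simp: h_def)
    have hD: "h ` \<Delta> = D"
      using img the_inv_into_onto [OF injD] by (simp add: h_def)
    have "(2 / cmod A)-lipschitz_on \<Delta> h"
    proof (rule lipschitz_onI)
      fix x y assume xy: "x \<in> \<Delta>" "y \<in> \<Delta>"
      then have "cmod A / 2 * cmod (h x - h y) \<le> cmod (x - y)"
        using expand [of "h x" "h y"] h DB by auto
      then show "dist (h x) (h y) \<le> 2 / cmod A * dist x y"
        using t by (simp add: dist_norm field_simps)
    qed simp
    then have "continuous_on \<Delta> h" by (rule lipschitz_on_continuous_on)
    then have "connected (h ` \<Delta>)" by (rule connected_continuous_image) (simp add: \<Delta>_def)
    then show ?thesis by (simp add: hD)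
  qed
  moreover have "g p \<in> \<Delta>" using \<kappa> by (simp add: \<Delta>_def)
  then have "D \<noteq> {}" using img by blast
  moreover have "bij_betw g D \<Delta>" using injD img by (simp add: bij_betw_def)
  ultimately show ?thesis
    unfolding covers_univalently_def \<Delta>_def using DB Bsub by blast
qed

section \<open>Dyadic descent in the half-plane\<close>

text \<open>Above height \<open>s\<close> the derivative is at most \<open>\<delta> / s\<close>, and
  this region is convex. The use: points whose distance is comparable to their height have values
  within a multiple of \<delta>.\<close>

lemma bloch_halfplane_lipschitz:
  assumes hol: "\<Phi> holomorphic_on {z. 0 < Im z}"
    and bloch: "\<And>z. 0 < Im z \<Longrightarrow> Im z * cmod (deriv \<Phi> z) \<le> \<delta>"
    and "0 < s" "s \<le> Im z" "s \<le> Im w"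
  shows "cmod (\<Phi> z - \<Phi> w) \<le> \<delta> / s * cmod (z - w)"
proof (rule field_differentiable_bound [where S = "{z. s \<le> Im z}" and f' = "deriv \<Phi>"])
  show "convex {z. s \<le> Im z}"
    by (rule convex_halfspace_Im_ge)
  fix u assume "u \<in> {z. s \<le> Im z}"
  then have u: "s \<le> Im u" by simp
  have o: "open {z. 0 < Im z}" by (simp add: open_halfspace_Im_gt)
  show "(\<Phi> has_field_derivative deriv \<Phi> u) (at u within {z. s \<le> Im z})"
    using holomorphic_derivI [OF hol o] u assms(3) by (meson has_field_derivative_at_within less_le_trans mem_Collect_eq)
  have "s * cmod (deriv \<Phi> u) \<le> Im u * cmod (deriv \<Phi> u)"
    using u by (intro mult_right_mono) auto
  also have "\<dots> \<le> \<delta>" using bloch u assms(3) by auto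
  finally show "cmod (deriv \<Phi> u) \<le> \<delta> / s"
    using assms(3) by (simp add: field_simps)
qed (use assms in auto)

lemma halfplane_vertical_derivative:
  assumes "(f has_field_derivative d) (at (Complex x y))"
  shows "((\<lambda>t. f (Complex x t)) has_vector_derivative (\<i> * d)) (at y)"
proof -
  have "((\<lambda>t. of_real x + t *\<^sub>R \<i>) has_vector_derivative \<i>) (at y)"
    by (auto intro!: derivative_eq_intros)
  also have "(\<lambda>t. of_real x + t *\<^sub>R \<i>) = Complex x"
    by (auto simp: complex_eq_iff)
  finally have "(Complex x has_vector_derivative \<i>) (at y)" .
  from field_vector_diff_chain_at [OF this assms] show ?thesis
    by (simp add: o_def)
qed

lemma halfplane_primitive:
  assumes "f holomorphic_on {z. 0 < Im z}"
  obtains F where "\<And>z. 0 < Im z \<Longrightarrow> (F has_field_derivative f z) (at z)"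
proof -
  have o: "open {z. 0 < Im z}" by (rule open_halfspace_Im_gt)
  obtain F where F: "\<And>z. z \<in> {z. 0 < Im z} \<Longrightarrow> (F has_field_derivative f z) (at z within {z. 0 < Im z})"
    using holomorphic_convex_primitive' [OF convex_halfspace_Im_gt o assms] by blast
  show ?thesis
    by (rule that [of F]) (use F at_within_open [OF _ o] in auto)
qed

text \<open>A primitive turns the mean of \<open>\<Psi>\<close> over a boundary interval into an additive interval function.\<close>

lemma interval_increment_approx:
  assumes hol: "\<Psi> holomorphic_on {z. 0 < Im z}"
    and bloch: "\<And>z. 0 < Im z \<Longrightarrow> Im z * cmod (deriv \<Psi> z) \<le> D"
    and F: "\<And>z. 0 < Im z \<Longrightarrow> (F has_field_derivative \<Psi> z) (at z)"
    and "0 < \<eta>" "\<eta> \<le> l"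
  shows "cmod (F (Complex (a + l) \<eta>) - F (Complex a \<eta>) - l * \<Psi> (Complex a l)) \<le> 8 * D * l"
proof -
  have l: "0 < l" using assms by auto
  have o: "open {z. 0 < Im z}" by (simp add: open_halfspace_Im_gt)
  have D: "0 \<le> D" using bloch [of \<i>] norm_ge_zero [of "deriv \<Psi> \<i>"] by (simp del: norm_ge_zero)
  define p where "p = Complex a l"
  \<comment> \<open>Subtracting the linear function of slope \<open>\<Psi> p\<close> leaves a
    primitive of \<open>\<Psi> - \<Psi> p\<close>, so only the increment of \<open>G\<close> has to
    be bounded.\<close>
  define G where "G z = F z - \<Psi> p * z" for z
  have G: "(G has_field_derivative \<Psi> z - \<Psi> p) (at z)" if "0 < Im z" for z
    unfolding G_def using that by (auto intro!: derivative_eq_intros F)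
  note lip = bloch_halfplane_lipschitz [OF hol bloch]
  have near: "cmod (\<Psi> z - \<Psi> p) \<le> D" if "Im z = l" "\<bar>Re z - a\<bar> \<le> l" for z
  proof -
    have "cmod (\<Psi> z - \<Psi> p) \<le> D / l * cmod (z - p)"
      using l that by (intro lip) (auto simp: p_def)
    also have "\<dots> = D / l * \<bar>Re z - a\<bar>"
      using that by (simp add: p_def cmod_def)
    also have "\<dots> \<le> D / l * l"
      using that D l by (intro mult_left_mono) auto
    finally show ?thesis using l by simp
  qed
  have top: "cmod (G (Complex (a + l) l) - G (Complex a l)) \<le> D * l"
  proof -
    have "cmod (G (Complex (a + l) l) - G (Complex a l)) \<le> D * cmod (Complex (a + l) l - Complex a l)"
    proof (rule field_differentiable_bound [where S = "closed_segment (Complex a l) (Complex (a + l) l)" and f' = "\<lambda>z. \<Psi> z - \<Psi> p"])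
      fix z assume z: "z \<in> closed_segment (Complex a l) (Complex (a + l) l)"
      then have z2: "Im z = l" "\<bar>Re z - a\<bar> \<le> l"
        using l by (auto simp: closed_segment_same_Im closed_segment_eq_real_ivl)
      then show "(G has_field_derivative \<Psi> z - \<Psi> p) (at z within closed_segment (Complex a l) (Complex (a + l) l))"
        using l by (auto intro!: has_field_derivative_at_within G)
      show "cmod (\<Psi> z - \<Psi> p) \<le> D" using near z2 by auto
    qed auto
    also have "cmod (Complex (a + l) l - Complex a l) = l"
      using l by (simp add: cmod_def)
    finally show ?thesis .
  qed
  have side: "cmod (G (Complex x l) - G (Complex x \<eta>)) \<le> 2 * D * l" if x: "x = a \<or> x = a + l" for x
  proof (cases "\<eta> = l")
    case True then show ?thesis using D l by simp
  next
    case False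
    then have less: "\<eta> < l" using assms by simp
    \<comment> \<open>The Bloch bound permits logarithmic growth of \<Psi> towards the boundary. The
      logarithm is integrable, so the primitive still varies by at most a multiple of
      \<open>D * l\<close> along a vertical side, uniformly in \<eta>.\<close>
    have log: "cmod (\<Psi> (Complex x l) - \<Psi> (Complex x y)) \<le> D * ln l - D * ln y" if y: "\<eta> < y" "y < l" for y
    proof (rule differentiable_bound_general [where f' = "\<lambda>t. \<i> * deriv \<Psi> (Complex x t)" and \<phi>' = "\<lambda>t. D / t"])
      have d: "((\<lambda>t. \<Psi> (Complex x t)) has_vector_derivative \<i> * deriv \<Psi> (Complex x t)) (at t)" if "y \<le> t" for t
        using that y assms by (intro halfplane_vertical_derivative holomorphic_derivI [OF hol o]) auto
      then show "continuous_on {y..l} (\<lambda>t. \<Psi> (Complex x t))"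
        by (intro continuous_at_imp_continuous_on ballI has_vector_derivative_continuous) auto
      show "continuous_on {y..l} (\<lambda>t. D * ln t)"
        using y assms by (intro continuous_intros) auto
      fix t assume t: "y < t" "t < l"
      show "((\<lambda>t. \<Psi> (Complex x t)) has_vector_derivative \<i> * deriv \<Psi> (Complex x t)) (at t)"
        using d t by simp
      show "((\<lambda>t. D * ln t) has_vector_derivative D / t) (at t)"
        using t y assms by (auto intro!: derivative_eq_intros simp flip: has_real_derivative_iff_has_vector_derivative)
      show "norm (\<i> * deriv \<Psi> (Complex x t)) \<le> D / t"
        using bloch [of "Complex x t"] t y assms by (simp add: norm_mult field_simps)
    qed (use y in auto)
    \<comment> \<open>A primitive of \<open>D * ln l - D * ln t + D\<close>, the bound on the
      integrand along the side.\<close>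
    define B where "B t = D * (t * ln l - t * ln t + t) + D * t" for t
    have "cmod (G (Complex x l) - G (Complex x \<eta>)) \<le> B l - B \<eta>"
    proof (rule differentiable_bound_general [where f' = "\<lambda>t. \<i> * (\<Psi> (Complex x t) - \<Psi> p)" and \<phi>' = "\<lambda>t. D * ln l - D * ln t + D"])
      show "\<eta> < l" by fact
      have d: "((\<lambda>t. G (Complex x t)) has_vector_derivative \<i> * (\<Psi> (Complex x t) - \<Psi> p)) (at t)" if "\<eta> \<le> t" for t
        using that assms by (intro halfplane_vertical_derivative G) auto
      then show "continuous_on {\<eta>..l} (\<lambda>t. G (Complex x t))"
        by (intro continuous_at_imp_continuous_on ballI has_vector_derivative_continuous) auto
      show "continuous_on {\<eta>..l} B"
        unfolding B_def using assms by (intro continuous_intros) auto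
      fix t assume t: "\<eta> < t" "t < l"
      show "((\<lambda>t. G (Complex x t)) has_vector_derivative \<i> * (\<Psi> (Complex x t) - \<Psi> p)) (at t)"
        using d t by simp
      show "(B has_vector_derivative D * ln l - D * ln t + D) (at t)"
        unfolding B_def using t assms
        by (auto intro!: derivative_eq_intros simp: algebra_simps simp flip: has_real_derivative_iff_has_vector_derivative)
      have "cmod (\<Psi> (Complex x t) - \<Psi> p) \<le> cmod (\<Psi> (Complex x l) - \<Psi> (Complex x t)) + cmod (\<Psi> (Complex x l) - \<Psi> p)"
        using norm_triangle_ineq4 [of "\<Psi> (Complex x l) - \<Psi> p" "\<Psi> (Complex x l) - \<Psi> (Complex x t)"] by simp
      also have "\<dots> \<le> (D * ln l - D * ln t) + D"
        using log t near [of "Complex x l"] x l by (intro add_mono) auto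
      finally show "norm (\<i> * (\<Psi> (Complex x t) - \<Psi> p)) \<le> D * ln l - D * ln t + D"
        by (simp add: norm_mult)
    qed
    also have "\<dots> = 2 * D * l - D * (\<eta> * (ln l - ln \<eta>) + 2 * \<eta>)"
      by (simp add: B_def algebra_simps)
    also have "\<dots> \<le> 2 * D * l"
      using D less assms by simp
    finally show ?thesis .
  qed
  \<comment> \<open>The two feet are joined over the top of the rectangle: up one side, across, and
    down the other, at a total cost of \<open>2 + 1 + 2\<close> multiples of
    \<open>D * l\<close>.\<close>
  have "G (Complex (a + l) \<eta>) - G (Complex a \<eta>) =
      (G (Complex (a + l) l) - G (Complex a l)) - (G (Complex (a + l) l) - G (Complex (a + l) \<eta>))
       + (G (Complex a l) - G (Complex a \<eta>))" by simp
  then have "cmod (G (Complex (a + l) \<eta>) - G (Complex a \<eta>)) \<le> D * l + 2 * D * l + 2 * D * l"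
    using top side [of a] side [of "a + l"]
    by (smt (verit, best) norm_triangle_ineq norm_triangle_ineq4)
  moreover have "Complex (a + l) \<eta> = Complex a \<eta> + of_real l"
    by (simp add: complex_eq_iff)
  then have "G (Complex (a + l) \<eta>) - G (Complex a \<eta>) = F (Complex (a + l) \<eta>) - F (Complex a \<eta>) - l * \<Psi> (Complex a l)"
    by (simp add: G_def p_def algebra_simps)
  moreover have "0 \<le> D * l" using D l by simp
  ultimately show ?thesis by simp
qed

text \<open>The quadratic comes from \<open>(x + 1/4) (1 - x) \<ge> 0\<close> on \<open>[-1/4, 1]\<close>: since \<open>x\<^sup>2 = (|c|\<^sup>2 + Re c\<^sup>2) / 2\<close>
  for \<open>x = Re c\<close>, it can be rewritten as the real part of a holomorphic function of \<open>c\<close> when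
  \<open>|c|\<close> is close to \<open>1\<close>.\<close>

lemma complex_quadratic_push:
  assumes "1 \<le> cmod c" "cmod c \<le> 21/20" "Re (3/4 * c - c\<^sup>2 / 2) < 37/200"
  shows "Re c < - 1/4"
proof (rule ccontr)
  assume "\<not> Re c < - 1/4"
  then have x: "-1/4 \<le> Re c" by simp
  have 1: "1 \<le> (Re c)\<^sup>2 + (Im c)\<^sup>2"
    using assms(1) by (metis cmod_power2 one_le_power)
  have 2: "Re c \<le> 21/20" using complex_Re_le_cmod [of c] assms by linarith
  have "Re (3/4 * c - c\<^sup>2 / 2) = 3/4 * Re c - ((Re c)\<^sup>2 - (Im c)\<^sup>2) / 2"
    by (simp add: power2_eq_square)
  also have "\<dots> \<ge> 3/4 * Re c - (Re c)\<^sup>2 + 1/2" using 1 by (simp add: field_simps)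
  \<comment> \<open>Allowing \<open>|c|\<close> up to \<open>21/20\<close> replaces the factor
    \<open>1 - x\<close> by \<open>21/20 - x\<close>, with an extra error
    \<open>x/20 \<le> 21/400\<close>. The threshold is what remains:
    \<open>1/2 - 21/80 - 21/400 = 37/200\<close>.\<close>
  moreover have "(Re c + 1/4) * (21/20 - Re c) \<ge> 0" using x 2 by simp
  then have "- (Re c)\<^sup>2 + 4/5 * Re c + 21/80 \<ge> 0" by (simp add: algebra_simps power2_eq_square)
  ultimately show False using assms(3) 2 x by linarith
qed

text \<open>Call an interval bad if the increment of the primitive of \<open>\<Psi>\<close> over it is small. The initial
  interval is bad, one half of a bad interval is bad, and a bad interval at which \<open>\<Phi>\<close> has moved away
  from \<open>w0\<close> by \<open>\<rho>\<close> has moved towards the origin, so that the descent restarts there.\<close>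

lemma dyadic_descent:
  assumes hol: "\<Phi> holomorphic_on {z. 0 < Im z}"
    and bloch: "\<And>z. 0 < Im z \<Longrightarrow> Im z * cmod (deriv \<Phi> z) \<le> \<delta>"
    and bdd: "\<And>z. 0 < Im z \<Longrightarrow> cmod (\<Phi> z) \<le> M"
    and par: "0 < \<rho>" "\<rho> \<le> 1" "1 \<le> M" "300 * M * \<delta> \<le> \<rho>\<^sup>2" "5 * \<rho> \<le> c" "0 < \<eta>"
  shows "cmod (\<Phi> (Complex a (\<eta> * 2 ^ m))) \<le> c \<Longrightarrow>
    \<exists>x\<in>{a..a + \<eta> * 2 ^ m}. \<forall>y\<in>{\<eta>..\<eta> * 2 ^ m}. cmod (\<Phi> (Complex x y)) \<le> c + 2 * \<rho>"
proof (induction m arbitrary: a rule: less_induct)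
  case (less m)
  have o: "open {z. 0 < Im z}" by (simp add: open_halfspace_Im_gt)
  have \<delta>: "0 \<le> \<delta>" using bloch [of \<i>] norm_ge_zero [of "deriv \<Phi> \<i>"] by (simp del: norm_ge_zero)
  have \<delta>\<rho>: "\<delta> \<le> \<rho> / 300"
  proof -
    have "300 * \<delta> * 1 \<le> 300 * \<delta> * M" using \<delta> par by (intro mult_left_mono) auto
    also have "\<dots> \<le> \<rho>\<^sup>2" using par by (simp add: algebra_simps)
    also have "\<dots> \<le> \<rho> * 1" unfolding power2_eq_square using par by (intro mult_left_mono) auto
    finally show ?thesis by simp
  qed
  note lip = bloch_halfplane_lipschitz [OF hol bloch]
  define w0 where "w0 = \<Phi> (Complex a (\<eta> * 2 ^ m))"
  define u where "u = (if w0 = 0 then 1 else sgn w0)"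
  have u: "cmod u = 1" "u \<noteq> 0" "w0 = of_real (cmod w0) * u"
    by (auto simp: u_def sgn_eq norm_divide)
  have w0: "cmod w0 \<le> c" "cmod w0 \<le> M" using less.prems bdd par by (auto simp: w0_def)
  \<comment> \<open>The displacement from \<open>w0\<close> in units of \<rho>, rotated so that the
    direction of \<open>w0\<close> becomes the positive real axis. A negative real part then points
    back towards the origin.\<close>
  define C where "C z = (\<Phi> z - w0) / (\<rho> * u)" for z
  have C\<Phi>: "\<Phi> z = w0 + \<rho> * u * C z" and nC: "cmod (\<Phi> z - w0) = \<rho> * cmod (C z)" for z
    using u par by (auto simp: C_def norm_mult norm_divide)
  define \<Psi> where "\<Psi> z = 3/4 * C z - (C z)\<^sup>2 / 2" for z
  define D where "D = (2 * M / \<rho> + 1) * (\<delta> / \<rho>)"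
  have D8: "8 * D \<le> 8 / 100"
  proof -
    have "D \<le> (3 * M / \<rho>) * (\<delta> / \<rho>)"
      unfolding D_def using par \<delta> by (intro mult_right_mono) (auto simp: field_simps)
    also have "\<dots> = 3 * M * \<delta> / \<rho>\<^sup>2" by (simp add: power2_eq_square)
    also have "\<dots> \<le> 1 / 100" using par by (simp add: field_simps)
    finally show ?thesis by simp
  qed
  have C': "(C has_field_derivative deriv \<Phi> z / (\<rho> * u)) (at z)" if "0 < Im z" for z
    unfolding C_def using that u par by (auto intro!: derivative_eq_intros holomorphic_derivI [OF hol o])
  have \<Psi>': "(\<Psi> has_field_derivative (3/4 - C z) * (deriv \<Phi> z / (\<rho> * u))) (at z)" if "0 < Im z" for z
    unfolding \<Psi>_def using that by (auto intro!: derivative_eq_intros C' simp: algebra_simps)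
  have hol\<Psi>: "\<Psi> holomorphic_on {z. 0 < Im z}"
    using \<Psi>' by (auto simp: holomorphic_on_open [OF o])
  have bloch\<Psi>: "Im z * cmod (deriv \<Psi> z) \<le> D" if z: "0 < Im z" for z
  proof -
    have "cmod (C z) \<le> 2 * M / \<rho>"
      using bdd [OF z] w0 par u norm_triangle_ineq4 [of "\<Phi> z" w0]
      by (auto simp: C_def norm_divide norm_mult field_simps)
    then have "cmod (3/4 - C z) \<le> 2 * M / \<rho> + 1"
      using norm_triangle_ineq4 [of "3/4" "C z"] by simp
    then have "cmod (3/4 - C z) * (Im z * cmod (deriv \<Phi> z) / \<rho>) \<le> D"
      unfolding D_def using bloch [OF z] par z by (intro mult_mono divide_right_mono) auto
    then show ?thesis
      using DERIV_imp_deriv [OF \<Psi>' [OF z]] par u by (simp add: norm_mult norm_divide mult_ac)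
  qed
  obtain F where F: "\<And>z. 0 < Im z \<Longrightarrow> (F has_field_derivative \<Psi> z) (at z)"
    using halfplane_primitive [OF hol\<Psi>] by blast
  note incr = interval_increment_approx [OF hol\<Psi> bloch\<Psi> F \<open>0 < \<eta>\<close>]
  \<comment> \<open>\<open>A\<close> is the negation of bad. The approximation error is 8/100 per
    unit length: an interval with \<open>\<Psi> = 0\<close> at its vertex stays below 1/10 and is
    bad, while badness forces \<open>Re \<Psi> < 18/100\<close>, which is below the threshold 37/200
    of \<open>complex_quadratic_push\<close>.\<close>
  define A where "A a k \<longleftrightarrow> \<eta> * 2 ^ k / 10 \<le> Re (F (Complex (a + \<eta> * 2 ^ k) \<eta>) - F (Complex a \<eta>))" for a k
  have incr2: "\<bar>Re (F (Complex (a + \<eta> * 2 ^ k) \<eta>) - F (Complex a \<eta>)) - \<eta> * 2 ^ k * Re (\<Psi> (Complex a (\<eta> * 2 ^ k)))\<bar>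
      \<le> 8/100 * (\<eta> * 2 ^ k)" for a k
  proof -
    have "\<bar>Re (F (Complex (a + \<eta> * 2 ^ k) \<eta>) - F (Complex a \<eta>) - of_real (\<eta> * 2 ^ k) * \<Psi> (Complex a (\<eta> * 2 ^ k)))\<bar>
      \<le> 8 * D * (\<eta> * 2 ^ k)"
    proof (rule order_trans [OF abs_Re_le_cmod incr])
      show "\<eta> \<le> \<eta> * 2 ^ k" using par by simp
    qed
    also have "\<dots> \<le> 8/100 * (\<eta> * 2 ^ k)"
      using D8 par by (intro mult_right_mono) auto
    finally show ?thesis by simp
  qed
  have stop: "cmod (\<Phi> (Complex a (\<eta> * 2 ^ k))) \<le> c"
    if nA: "\<not> A a k" and far: "\<rho> \<le> cmod (\<Phi> (Complex a (\<eta> * 2 ^ k)) - w0)"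
      "cmod (\<Phi> (Complex a (\<eta> * 2 ^ k)) - w0) \<le> 21/20 * \<rho>" for a k
  proof -
    define p where "p = Complex a (\<eta> * 2 ^ k)"
    have pos: "0 < \<eta> * 2 ^ k" using par by simp
    have Cp: "1 \<le> cmod (C p)" "cmod (C p) \<le> 21/20"
      using far par by (auto simp: nC p_def)
    have "\<eta> * 2 ^ k * Re (\<Psi> p) < \<eta> * 2 ^ k * (18/100)"
      using nA incr2 [of a k] unfolding A_def p_def by linarith
    then have "Re (\<Psi> p) < 18/100" using mult_less_cancel_left_pos [OF pos] by blast
    then have x: "Re (C p) < - 1/4"
      by (intro complex_quadratic_push Cp) (simp add: \<Psi>_def)
    \<comment> \<open>For \<open>|w0| \<ge> 3 \<rho>\<close> the gain \<open>\<rho> |w0| / 2\<close>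
      from the cross term outweighs the square of the displacement, at most
      \<open>(21/20)^2 \<rho>^2\<close>. For smaller \<open>w0\<close> the new value is below
      \<open>5 \<rho> \<le> c\<close> by the triangle inequality alone.\<close>
    show ?thesis
    proof (cases "3 * \<rho> \<le> cmod w0")
      case True
      have "\<Phi> p = (cmod w0 + \<rho> * C p) * u"
        by (subst C\<Phi>, subst u(3)) (simp add: algebra_simps)
      then have "(cmod (\<Phi> p))\<^sup>2 = (cmod (cmod w0 + \<rho> * C p))\<^sup>2"
        by (simp add: norm_mult u(1))
      also have "\<dots> = (cmod w0)\<^sup>2 + 2 * \<rho> * cmod w0 * Re (C p) + \<rho>\<^sup>2 * (cmod (C p))\<^sup>2"
        by (simp add: cmod_power2 power2_sum algebra_simps power_mult_distrib)
      also have "\<dots> \<le> (cmod w0)\<^sup>2 - 2 * \<rho> * cmod w0 * (1/4) + \<rho>\<^sup>2 * (21/20)\<^sup>2"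
      proof -
        have "2 * \<rho> * cmod w0 * Re (C p) \<le> 2 * \<rho> * cmod w0 * (- 1/4)"
          using x par by (intro mult_left_mono) auto
        moreover have "\<rho>\<^sup>2 * (cmod (C p))\<^sup>2 \<le> \<rho>\<^sup>2 * (21/20)\<^sup>2"
          using Cp by (intro mult_left_mono power_mono) auto
        ultimately show ?thesis by linarith
      qed
      also have "\<dots> = (cmod w0)\<^sup>2 - \<rho> * (cmod w0 / 2 - 441/400 * \<rho>)"
        by (simp add: algebra_simps power2_eq_square)
      also have "\<dots> \<le> (cmod w0)\<^sup>2"
        using True par by simp
      finally have "cmod (\<Phi> p) \<le> cmod w0" by (rule power2_le_imp_le) simp
      then show ?thesis using w0 by (simp add: p_def)
    next
      case False
      then show ?thesis
        using far norm_triangle_ineq2 [of "\<Phi> p" w0] par by (simp add: p_def)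
    qed
  qed
  \<comment> \<open>An inner induction on the scale follows bad halves while the value stays within
    \<rho> of \<open>w0\<close>. Once it has left this disc, \<open>stop\<close> applies and the
    outer induction hypothesis takes over. The last hypothesis guarantees that such a restart
    happens at a scale strictly below \<open>m\<close>.\<close>
  have claim: "\<exists>x\<in>{a'..a' + \<eta> * 2 ^ k}. \<forall>y\<in>{\<eta>..\<eta> * 2 ^ k}. cmod (\<Phi> (Complex x y)) \<le> c + 2 * \<rho>"
    if "k \<le> m" "\<not> A a' k" "cmod (\<Phi> (Complex a' (\<eta> * 2 ^ k)) - w0) \<le> 21/20 * \<rho>"
      "k < m \<or> cmod (\<Phi> (Complex a' (\<eta> * 2 ^ k)) - w0) < \<rho>" for k a'
    using that
  proof (induction k arbitrary: a')
    case k: 0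
    have "cmod (\<Phi> (Complex a' \<eta>)) \<le> c + 2 * \<rho>"
      using k.prems(3) w0 par norm_triangle_sub [of "\<Phi> (Complex a' \<eta>)" w0] by simp
    then show ?case using par by (intro bexI [of _ a']) auto
  next
    case (Suc k)
    define p where "p = Complex a' (\<eta> * 2 ^ Suc k)"
    define l where "l = \<eta> * 2 ^ k"
    have l: "0 < l" "\<eta> \<le> l" "\<eta> * 2 ^ Suc k = 2 * l" using par by (auto simp: l_def)
    show ?case
    proof (cases "\<rho> \<le> cmod (\<Phi> p - w0)")
      case True
      then have "Suc k < m" "cmod (\<Phi> p) \<le> c"
        using Suc.prems stop [of a' "Suc k"] by (auto simp: p_def)
      then show ?thesis using less.IH [of "Suc k" a'] by (auto simp: p_def)
    next
      case False
      have near: "cmod (\<Phi> z - \<Phi> p) \<le> 4 * \<delta>" if "l \<le> Im z" "Im z \<le> 2 * l" "a' \<le> Re z" "Re z \<le> a' + 2 * l" for z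
      proof -
        have "cmod (z - p) \<le> \<bar>Re (z - p)\<bar> + \<bar>Im (z - p)\<bar>" by (rule cmod_le)
        also have "\<dots> \<le> 4 * l" using that l by (auto simp: p_def simp del: power_Suc)
        finally have "\<delta> / l * cmod (z - p) \<le> \<delta> / l * (4 * l)"
          using \<delta> l by (intro mult_left_mono) auto
        then show ?thesis
          using lip [of l z p] that l by (simp add: p_def del: power_Suc)
      qed
      \<comment> \<open>Increments of the primitive add up, so two good halves would make a good
        interval.\<close>
      have "\<not> A a' k \<or> \<not> A (a' + l) k"
        using Suc.prems(2) unfolding A_def l(3) l_def [symmetric] by (auto simp: algebra_simps)
      then obtain a'' where a'': "a'' = a' \<or> a'' = a' + l" "\<not> A a'' k" by auto
      have "cmod (\<Phi> (Complex a'' l) - \<Phi> p) \<le> 4 * \<delta>"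
        using a'' l by (intro near) auto
      \<comment> \<open>One halving changes the value by at most
        \<open>4 * \<delta> < \<rho> / 20\<close>, so the disc of radius \<rho> is overshot by at
        most the factor 21/20.\<close>
      then have c1: "cmod (\<Phi> (Complex a'' l) - w0) \<le> 21/20 * \<rho>"
        using False \<delta>\<rho> par norm_triangle_ineq [of "\<Phi> (Complex a'' l) - \<Phi> p" "\<Phi> p - w0"] by simp
      have "\<exists>x\<in>{a''..a'' + l}. \<forall>y\<in>{\<eta>..l}. cmod (\<Phi> (Complex x y)) \<le> c + 2 * \<rho>"
        using Suc.IH [of a''] Suc.prems(1) a'' c1 by (simp add: l_def)
      then obtain x where x: "x \<in> {a''..a'' + l}" "\<And>y. y \<in> {\<eta>..l} \<Longrightarrow> cmod (\<Phi> (Complex x y)) \<le> c + 2 * \<rho>"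
        by auto
      have "cmod (\<Phi> (Complex x y)) \<le> c + 2 * \<rho>" if "y \<in> {\<eta>..2 * l}" for y
      proof (cases "y \<le> l")
        case True then show ?thesis using x that by auto
      next
        case False': False
        have "cmod (\<Phi> (Complex x y) - \<Phi> p) \<le> 4 * \<delta>"
          using a'' x l False' that by (intro near) auto
        moreover have "cmod (\<Phi> (Complex x y)) \<le> cmod (\<Phi> (Complex x y) - \<Phi> p) + cmod (\<Phi> p - w0) + cmod w0"
          using norm_triangle_ineq [of "\<Phi> (Complex x y) - \<Phi> p" "\<Phi> p - w0"]
            norm_triangle_ineq [of "\<Phi> (Complex x y) - w0" w0] by simp
        ultimately show ?thesis using False w0 \<delta>\<rho> par by simp
      qed
      then show ?thesis
        unfolding l(3) using x(1) a''(1) l by (intro bexI [of _ x]) auto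
    qed
  qed
  have "\<Psi> (Complex a (\<eta> * 2 ^ m)) = 0"
    by (simp add: \<Psi>_def C_def w0_def)
  moreover have "0 < \<eta> * 2 ^ m" using par by simp
  ultimately have "\<not> A a m"
    using incr2 [of a m] unfolding A_def
    by (simp only: abs_le_iff mult_zero_right complex.sel zero_complex.sel) linarith
  then show ?case
    using claim [of m a] par by (simp add: w0_def)
qed

text \<open>Descent from height \<open>l\<close> to height \<open>l / 2 ^ m\<close> gives a foot
  \<open>X m\<close> for every \<open>m\<close>. A limit point of these feet in the compact base
  serves all heights at once, by continuity at each fixed height.\<close>

lemma halfplane_vertical_ray:
  assumes hol: "\<Phi> holomorphic_on {z. 0 < Im z}"
    and bloch: "\<And>z. 0 < Im z \<Longrightarrow> Im z * cmod (deriv \<Phi> z) \<le> \<delta>"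
    and bdd: "\<And>z. 0 < Im z \<Longrightarrow> cmod (\<Phi> z) \<le> M"
    and par: "0 < \<rho>" "\<rho> \<le> 1" "1 \<le> M" "300 * M * \<delta> \<le> \<rho>\<^sup>2" "5 * \<rho> \<le> c"
    and "0 < l" "cmod (\<Phi> (Complex a l)) \<le> c"
  shows "\<exists>x\<in>{a..a + l}. \<forall>y. 0 < y \<and> y \<le> l \<longrightarrow> cmod (\<Phi> (Complex x y)) \<le> c + 2 * \<rho>"
proof -
  have "\<exists>x\<in>{a..a + l}. \<forall>y\<in>{l / 2 ^ m..l}. cmod (\<Phi> (Complex x y)) \<le> c + 2 * \<rho>" for m
    using dyadic_descent [OF hol bloch bdd par, of "l / 2 ^ m" a m] assms by simp
  then obtain X where X: "\<And>m. X m \<in> {a..a + l}"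
    "\<And>m y. y \<in> {l / 2 ^ m..l} \<Longrightarrow> cmod (\<Phi> (Complex (X m) y)) \<le> c + 2 * \<rho>"
    by metis
  obtain x r where x: "x \<in> {a..a + l}" "strict_mono (r :: nat \<Rightarrow> nat)" "(X \<circ> r) \<longlonglongrightarrow> x"
    using compact_Icc [of a "a + l"] X(1) unfolding compact_def by metis
  have "cmod (\<Phi> (Complex x y)) \<le> c + 2 * \<rho>" if y: "0 < y" "y \<le> l" for y
  proof (rule tendsto_upperbound)
    have "isCont \<Phi> (Complex x y)"
      using y by (intro holomorphic_on_imp_continuous_on [OF hol, THEN continuous_on_interior])
        (simp add: interior_open open_halfspace_Im_gt)
    moreover have "(\<lambda>n. Complex (X (r n)) y) \<longlonglongrightarrow> Complex x y"
      using x(3) by (auto intro!: tendsto_Complex simp: o_def)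
    ultimately have "(\<lambda>n. \<Phi> (Complex (X (r n)) y)) \<longlonglongrightarrow> \<Phi> (Complex x y)"
      by (rule isCont_tendsto_compose)
    then show "(\<lambda>n. cmod (\<Phi> (Complex (X (r n)) y))) \<longlonglongrightarrow> cmod (\<Phi> (Complex x y))"
      by (rule tendsto_norm)
    have "(\<lambda>n. l / 2 ^ n) \<longlonglongrightarrow> 0"
      by (rule LIMSEQ_divide_realpow_zero) auto
    then have "\<forall>\<^sub>F n in sequentially. l / 2 ^ n < y"
      using y by (auto dest: order_tendstoD)
    then have "\<forall>\<^sub>F n in sequentially. l / 2 ^ r n < y"
      using filterlim_subseq [OF x(2)] by (rule eventually_compose_filterlim)
    then show "\<forall>\<^sub>F n in sequentially. cmod (\<Phi> (Complex (X (r n)) y)) \<le> c + 2 * \<rho>"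
      by eventually_elim (use X y in auto)
  qed simp
  with x(1) show ?thesis by blast
qed

section \<open>Arcs with boundary values of modulus at least one\<close>

lemma cis_exp_Complex: "exp (\<i> * Complex x y) = of_real (exp (- y)) * cis x"
  by (simp add: exp_eq_polar)

text \<open>If the derivative were small everywhere, \<open>z \<mapsto> exp (\<i> * z)\<close> would
  carry the Bloch bound to the half-plane and vertical rays to radii. Descent over an interval
  inside the arc then produces one radius, ending in the arc, near whose end the modulus stays below
  a constant less than 1. As the radial condition holds at every point of the arc, this single
  radius is a contradiction.\<close>

lemma arc_forces_large_derivative:
  assumes hol: "\<phi> holomorphic_on ball 0 1"
    and bdd: "\<And>z. cmod z < 1 \<Longrightarrow> cmod (\<phi> z) \<le> M" and M: "1 \<le> M"
    and b: "cmod (\<phi> 0) \<le> b" "1/2 \<le> b" "b < 1"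
    and arc: "circle_arc \<gamma> l" "\<alpha> < l" "0 < \<alpha>"
    and lim: "\<And>\<zeta>. \<zeta> \<in> \<gamma> \<Longrightarrow> 1 \<le> Liminf (at_left 1) (\<lambda>t. ereal (cmod (\<phi> (of_real t * \<zeta>))))"
    and \<delta>: "0 < \<delta>" "30000 * M * \<delta> \<le> (1 - b)\<^sup>2" "10 * \<delta> \<le> (1 - b) * (1 - exp (- \<alpha> / 2))"
  shows "\<exists>z. cmod z < 1 \<and> \<delta> < (1 - (cmod z)\<^sup>2) * cmod (deriv \<phi> z)"
proof (rule ccontr)
  assume "\<not> ?thesis"
  then have bloch: "(1 - (cmod z)\<^sup>2) * cmod (deriv \<phi> z) \<le> \<delta>" if "cmod z < 1" for z
    using that by (metis not_less)
  define e where "e = 1 - b"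
  have e: "0 < e" "e \<le> 1/2" using b by (auto simp: e_def)
  define E where "E z = exp (\<i> * z)" for z
  have nE: "cmod (E z) = exp (- Im z)" for z by (simp add: E_def norm_exp_eq_Re)
  have E1: "cmod (E z) < 1" if "0 < Im z" for z using that by (simp add: nE)
  define \<Phi> where "\<Phi> z = \<phi> (E z)" for z
  have \<Phi>': "(\<Phi> has_field_derivative deriv \<phi> (E z) * (\<i> * E z)) (at z)" if "0 < Im z" for z
  proof -
    have "(\<phi> has_field_derivative deriv \<phi> (E z)) (at (E z))"
      using E1 [OF that] by (intro holomorphic_derivI [OF hol]) auto
    moreover have "(E has_field_derivative \<i> * E z) (at z)"
      unfolding E_def by (auto intro!: derivative_eq_intros)
    ultimately show ?thesis unfolding \<Phi>_def by (rule DERIV_chain2)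
  qed
  have o: "open {z. 0 < Im z}" by (rule open_halfspace_Im_gt)
  have hol\<Phi>: "\<Phi> holomorphic_on {z. 0 < Im z}"
    using \<Phi>' by (auto simp: holomorphic_on_open [OF o])
  have bloch\<Phi>: "Im z * cmod (deriv \<Phi> z) \<le> \<delta>" if z: "0 < Im z" for z
  proof -
    define y where "y = Im z"
    have y: "0 < y" using z by (simp add: y_def)
    \<comment> \<open>Comparison of the weights of half-plane and disc: after multiplication by
      \<open>exp y\<close> it reads \<open>y \<le> exp y - exp (- y)\<close>.\<close>
    have "y * exp (- y) \<le> 1 - (exp (- y))\<^sup>2"
    proof -
      have "1 + y \<le> exp y" by (rule exp_ge_add_one_self)
      moreover have "exp (- y) \<le> 1" using y by simp
      ultimately have "y \<le> exp y - exp (- y)" by linarith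
      then have "y * exp (- y) \<le> (exp y - exp (- y)) * exp (- y)" by (intro mult_right_mono) auto
      also have "\<dots> = 1 - (exp (- y))\<^sup>2" by (simp add: algebra_simps power2_eq_square flip: exp_add)
      finally show ?thesis .
    qed
    then have "(y * exp (- y)) * cmod (deriv \<phi> (E z)) \<le> (1 - (cmod (E z))\<^sup>2) * cmod (deriv \<phi> (E z))"
      by (intro mult_right_mono) (auto simp: nE y_def)
    also have "\<dots> \<le> \<delta>" using bloch E1 z by auto
    finally show ?thesis
      using DERIV_imp_deriv [OF \<Phi>' [OF z]] by (simp add: norm_mult nE y_def mult_ac)
  qed
  obtain a I where aI: "{a<..<a + l} \<subseteq> I" "\<gamma> = cis ` I"
    using arc(1) by (auto simp: circle_arc_def)
  \<comment> \<open>The base \<open>[a + h, a + 2 h]\<close> lies inside the open arc since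
    \<open>2 h = \<alpha> / 2 < l\<close>. The starting height \<open>h\<close> puts the first point
    at modulus \<open>q = exp (- h)\<close>, with \<open>q^2 = exp (- \<alpha> / 2)\<close> as in
    the hypothesis on \<delta>.\<close>
  define h where "h = \<alpha> / 4"
  have h: "0 < h" using arc by (simp add: h_def)
  define q where "q = exp (- h)"
  have q: "0 < q" "q < 1" using h by (auto simp: q_def)
  have start: "cmod (\<Phi> (Complex (a + h) h)) \<le> b + e / 10"
  proof -
    have "cmod (\<phi> (E (Complex (a + h) h)) - \<phi> 0) \<le> \<delta> / (1 - q\<^sup>2) * cmod (E (Complex (a + h) h) - 0)"
    proof (rule field_differentiable_bound [where S = "cball 0 q" and f' = "deriv \<phi>"])
      fix z :: complex assume z: "z \<in> cball 0 q"
      then have z1: "cmod z \<le> q" "cmod z < 1" using q by auto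
      then show "(\<phi> has_field_derivative deriv \<phi> z) (at z within cball 0 q)"
        by (intro has_field_derivative_at_within [OF holomorphic_derivI [OF hol]]) auto
      have "(cmod z)\<^sup>2 \<le> q\<^sup>2" using z1 by (intro power_mono) auto
      then have "(1 - q\<^sup>2) * cmod (deriv \<phi> z) \<le> (1 - (cmod z)\<^sup>2) * cmod (deriv \<phi> z)"
        by (intro mult_right_mono) auto
      also have "\<dots> \<le> \<delta>" using bloch z1 by auto
      finally show "cmod (deriv \<phi> z) \<le> \<delta> / (1 - q\<^sup>2)"
        using q by (simp add: field_simps power_less_one_iff abs_square_less_1)
    qed (use q in \<open>auto simp: nE q_def\<close>)
    also have "\<dots> \<le> \<delta> / (1 - q\<^sup>2) * 1"
      using q \<delta> h by (intro mult_left_mono) (auto simp: nE abs_square_le_1 power_le_one)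
    also have "q\<^sup>2 = exp (- \<alpha> / 2)" by (simp add: q_def h_def power2_eq_square flip: exp_add)
    also have "\<delta> / (1 - exp (- \<alpha> / 2)) * 1 \<le> e / 10"
      using \<delta> arc by (simp add: field_simps e_def)
    finally show ?thesis
      using b norm_triangle_sub [of "\<phi> (E (Complex (a + h) h))" "\<phi> 0"] by (simp add: \<Phi>_def)
  qed
  \<comment> \<open>Descent with \<open>\<rho> = e / 10\<close> and \<open>c = b + e / 10\<close>.
    Here \<open>5 \<rho> = e / 2 \<le> c\<close> because \<open>b \<ge> 1/2\<close>, and the final
    bound \<open>b + 3/10 * e\<close> is below \<open>b + e = 1\<close>.\<close>
  have "\<exists>x\<in>{a + h..a + h + h}. \<forall>y. 0 < y \<and> y \<le> h \<longrightarrow> cmod (\<Phi> (Complex x y)) \<le> (b + e / 10) + 2 * (e / 10)"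
  proof (rule halfplane_vertical_ray [OF hol\<Phi> bloch\<Phi>])
    show "cmod (\<Phi> z) \<le> M" if "0 < Im z" for z using bdd E1 that by (simp add: \<Phi>_def)
    show "300 * M * \<delta> \<le> (e / 10)\<^sup>2"
      using \<delta>(2) by (simp add: e_def power_divide)
  qed (use e M b h start in auto)
  then obtain x where x: "a + h \<le> x" "x \<le> a + h + h"
    "\<And>y. \<lbrakk>0 < y; y \<le> h\<rbrakk> \<Longrightarrow> cmod (\<Phi> (Complex x y)) \<le> b + 3/10 * e"
    by (force simp: field_simps)
  have "x \<in> {a<..<a + l}" using x(1,2) h arc by (auto simp: h_def)
  then have "cis x \<in> \<gamma>" using aI by auto
  then have "1 \<le> Liminf (at_left 1) (\<lambda>t. ereal (cmod (\<phi> (of_real t * cis x))))" by (rule lim)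
  also have "\<dots> \<le> Limsup (at_left 1) (\<lambda>t. ereal (cmod (\<phi> (of_real t * cis x))))"
    by (intro Liminf_le_Limsup) simp
  also have "\<dots> \<le> ereal (b + 3/10 * e)"
  proof (rule Limsup_bounded)
    have "\<forall>\<^sub>F t in at_left 1. t \<in> {q<..<1}"
      using q by (intro eventually_at_left_real) auto
    then show "\<forall>\<^sub>F t in at_left 1. ereal (cmod (\<phi> (of_real t * cis x))) \<le> ereal (b + 3/10 * e)"
    proof eventually_elim
      case (elim t)
      then have t: "0 < t" "q < t" "t < 1" using q by auto
      have "ln q < ln t" using t q by simp
      then have "- ln t \<le> h" by (simp add: q_def)
      moreover have "0 < - ln t" using t by simp
      ultimately have "cmod (\<Phi> (Complex x (- ln t))) \<le> b + 3/10 * e" by (rule x(3) [rotated])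
      moreover have "E (Complex x (- ln t)) = of_real t * cis x"
        using t unfolding E_def cis_exp_Complex by simp
      ultimately show ?case by (simp add: \<Phi>_def)
    qed
  qed
  also have "\<dots> < 1" using b(3) by (simp add: e_def one_ereal_def field_simps)
  finally show False by simp
qed

section \<open>Radial limits of bounded holomorphic functions\<close>

text \<open>The increasing function \<open>k x = G x + (C + 1) x\<close> and its inverse are Lipschitz, so the image of
  Lebesgue measure under the inverse is absolutely continuous; its density is the derivative of \<open>k\<close>.\<close>

lemma lipschitz_real_right_derivative_ae:
  fixes G :: "real \<Rightarrow> real"
  assumes lip: "C-lipschitz_on UNIV G"
  obtains N where "negligible N"
    "\<And>x. x \<notin> N \<Longrightarrow> \<exists>d. ((\<lambda>h. (G (x + h) - G x) / h) \<longlongrightarrow> d) (at_right 0)"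
proof -
  define k where "k x = G x + (C + 1) * x" for x
  have C: "0 \<le> C" using lip by (rule lipschitz_on_nonneg)
  have Gxy: "\<bar>G y - G x\<bar> \<le> C * \<bar>y - x\<bar>" for x y
    using lipschitz_onD [OF lip, of y x] by (simp add: dist_real_def)
  have k_lower: "y - x \<le> k y - k x" if "x \<le> y" for x y
    using Gxy [of y x] that by (simp add: k_def algebra_simps)
  have k_lip: "\<bar>k y - k x\<bar> \<le> (2 * C + 1) * \<bar>y - x\<bar>" for x y
  proof -
    have "\<bar>k y - k x\<bar> = \<bar>(G y - G x) + (C + 1) * (y - x)\<bar>" by (simp add: k_def algebra_simps)
    also have "\<dots> \<le> \<bar>G y - G x\<bar> + \<bar>(C + 1) * (y - x)\<bar>" by (rule abs_triangle_ineq)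
    also have "\<bar>(C + 1) * (y - x)\<bar> = (C + 1) * \<bar>y - x\<bar>" using C by (simp add: abs_mult)
    finally show ?thesis using Gxy [of y x] by (simp add: algebra_simps)
  qed
  have k_mono: "k x \<le> k y \<longleftrightarrow> x \<le> y" for x y
    using k_lower [of x y] k_lower [of y x] by linarith
  have k_cont: "continuous_on UNIV k"
    unfolding k_def by (intro continuous_intros lipschitz_on_continuous_on [OF lip])
  have "\<exists>x. k x = y" for y
  proof -
    define t where "t = \<bar>y - k 0\<bar>"
    have "\<exists>x\<ge>-t. x \<le> t \<and> k x = y"
    proof (rule IVT')
      show "k (- t) \<le> y" using k_lower [of "- t" 0] by (simp add: t_def)
      show "y \<le> k t" using k_lower [of 0 t] by (simp add: t_def)
      show "continuous_on {- t..t} k" by (rule continuous_on_subset [OF k_cont]) simp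
    qed (simp add: t_def)
    then show ?thesis by blast
  qed
  then obtain P where P: "\<And>y. k (P y) = y" by metis
  have Pk: "P (k x) = x" for x
    using P [of "k x"] k_mono by (metis order_antisym order_refl)
  have "mono P"
    using P k_mono by (metis monoI)
  then have [measurable]: "P \<in> borel_measurable borel" by (rule borel_measurable_mono)
  \<comment> \<open>Images under \<open>k\<close> are preimages under \<open>P\<close>, hence Borel
    for Borel sets, and \<nu> measures a set by the length of its image under
    \<open>k\<close>.\<close>
  have Pvim: "P -` A = k ` A" for A
    using P Pk by (auto simp: image_iff) metis
  define \<nu> where "\<nu> = distr lborel borel P"
  have em: "emeasure \<nu> A = emeasure lborel (k ` A)" if "A \<in> sets borel" for A
    using that by (simp add: \<nu>_def emeasure_distr Pvim)
  have "absolutely_continuous lborel \<nu>"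
    unfolding absolutely_continuous_def
  proof
    fix A assume A: "A \<in> null_sets (lborel :: real measure)"
    then have bA: "A \<in> sets borel" by (auto simp: null_sets_def)
    have "negligible A"
      using A by (simp add: negligible_iff_null_sets null_sets_completionI)
    then have "negligible (k ` A)"
    proof (rule negligible_locally_Lipschitz_image [OF order_refl])
      fix x
      show "\<exists>T B. open T \<and> x \<in> T \<and> (\<forall>y\<in>A \<inter> T. norm (k y - k x) \<le> B * norm (y - x))"
        using k_lip by (intro exI [of _ UNIV] exI [of _ "2 * C + 1"]) auto
    qed
    moreover have "k ` A \<in> sets borel"
      using measurable_sets [of P borel borel A] bA by (simp add: Pvim)
    ultimately have "emeasure lborel (k ` A) = 0"
      by (auto simp: negligible_iff_null_sets null_sets_def)
    then show "A \<in> null_sets \<nu>"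
      using bA em by (auto simp: null_sets_def \<nu>_def)
  qed
  then obtain f where f [measurable]: "f \<in> borel_measurable lborel" and dens: "density lborel f = \<nu>"
    using sigma_finite_measure.Radon_Nikodym [OF sigma_finite_lborel, of \<nu>] by (auto simp: \<nu>_def)
  have ints: "(\<integral>\<^sup>+x. f x * indicator {a..b} x \<partial>lborel) = ennreal (k b - k a)" if "a \<le> b" for a b
  proof -
    have "(\<integral>\<^sup>+x. f x * indicator {a..b} x \<partial>lborel) = emeasure \<nu> {a..b}"
      by (simp flip: dens add: emeasure_density)
    also have "\<dots> = emeasure lborel (k ` {a..b})" by (simp add: em)
    also have "k ` {a..b} = {k a..k b}"
    proof -
      have "a \<le> P y \<longleftrightarrow> k a \<le> y" "P y \<le> b \<longleftrightarrow> y \<le> k b" for y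
        using k_mono [of a "P y"] k_mono [of "P y" b] P by simp_all
      then have "P -` {a..b} = {k a..k b}" by auto
      then show ?thesis by (simp add: Pvim)
    qed
    finally show ?thesis using that k_mono by simp
  qed
  \<comment> \<open>The Radon-Nikodym density may take the value infinity, but only on a null set,
    since its integral over each bounded interval is an increment of \<open>k\<close>.\<close>
  have fin: "AE x in lborel. f x \<noteq> \<infinity>"
  proof -
    have "AE x in lborel. f x * indicator {- real n..real n} x \<noteq> \<infinity>" for n
      by (rule nn_integral_PInf_AE) (use ints [of "- real n" "real n"] in auto)
    then have "AE x in lborel. \<forall>n. f x * indicator {- real n..real n} x \<noteq> \<infinity>"
      by (simp add: AE_all_countable)
    then show ?thesis
    proof eventually_elim
      case (elim x)
      obtain n where "\<bar>x\<bar> \<le> real n" using real_arch_simple by blast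
      then have "x \<in> {- real n..real n}" by auto
      then show ?case using elim [rule_format, of n] by simp
    qed
  qed
  define g where "g x = enn2real (f x)" for x
  have [measurable]: "g \<in> borel_measurable borel"
    using f unfolding g_def by simp
  have g_int: "(g has_integral (k b - k a)) {a..b}" if "a \<le> b" for a b
  proof -
    have "(\<integral>\<^sup>+x. ennreal (indicator {a..b} x *\<^sub>R g x) \<partial>lborel) = (\<integral>\<^sup>+x. f x * indicator {a..b} x \<partial>lborel)"
    proof (rule nn_integral_cong_AE)
      show "AE x in lborel. ennreal (indicator {a..b} x *\<^sub>R g x) = f x * indicator {a..b} x"
        using fin by eventually_elim (auto simp: g_def indicator_def less_top)
    qed
    then have nn: "(\<integral>\<^sup>+x. ennreal (indicator {a..b} x *\<^sub>R g x) \<partial>lborel) = ennreal (k b - k a)"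
      using ints that by simp
    have "integrable lborel (\<lambda>x. indicator {a..b} x *\<^sub>R g x)"
    proof (rule integrableI_nonneg)
      show "(\<integral>\<^sup>+x. ennreal (indicator {a..b} x *\<^sub>R g x) \<partial>lborel) < \<infinity>"
        by (simp only: nn) simp
    qed (auto simp: g_def)
    then have si: "set_integrable lborel {a..b} g" by (simp add: set_integrable_def)
    have "(LINT x : {a..b} | lborel. g x) = k b - k a"
      unfolding set_lebesgue_integral_def
      using nn k_mono that by (subst integral_eq_nn_integral) (auto simp: g_def)
    then show ?thesis
      using set_borel_integral_eq_integral [OF si] by (simp add: has_integral_integral)
  qed
  have "g integrable_on cbox a b" for a b
    using g_int [of a b] by (cases "a \<le> b") (auto simp: has_integral_integrable)
  \<comment> \<open>Lebesgue differentiation along intervals \<open>[x, x + h]\<close> with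
    \<open>h > 0\<close>; this is why the derivative obtained is one-sided.\<close>
  then obtain N where N: "negligible N"
    "\<And>x e. \<lbrakk>x \<notin> N; 0 < e\<rbrakk> \<Longrightarrow> \<exists>d>0. \<forall>h. 0 < h \<and> h < d \<longrightarrow>
       norm (integral (cbox x (x + h *\<^sub>R One)) g /\<^sub>R h ^ DIM(real) - g x) < e"
    using integrable_ccontinuous_explicit [of g] by blast
  show ?thesis
  proof (rule that [OF N(1)])
    fix x assume x: "x \<notin> N"
    have "((\<lambda>h. (G (x + h) - G x) / h) \<longlongrightarrow> g x - (C + 1)) (at_right 0)"
    proof (rule tendstoI)
      fix e :: real assume "0 < e"
      then obtain d where d: "0 < d"
        "\<forall>h. 0 < h \<and> h < d \<longrightarrow> \<bar>integral {x..x + h} g / h - g x\<bar> < e"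
        using N(2) [OF x] by (force simp: divide_inverse_commute)
      have "dist ((G (x + h) - G x) / h) (g x - (C + 1)) < e" if "0 < h" "h < d" for h
      proof -
        have "integral {x..x + h} g = (G (x + h) - G x) + (C + 1) * h"
          using g_int [of x "x + h"] that by (simp add: integral_unique k_def algebra_simps)
        then have "integral {x..x + h} g / h = (G (x + h) - G x) / h + (C + 1)"
          using that by (simp add: field_simps)
        then show ?thesis using d(2) [rule_format, of h] that by (simp add: dist_real_def algebra_simps)
      qed
      then show "\<forall>\<^sub>F h in at_right 0. dist ((G (x + h) - G x) / h) (g x - (C + 1)) < e"
        using d(1) by (auto simp: eventually_at_right_field)
    qed
    then show "\<exists>d. ((\<lambda>h. (G (x + h) - G x) / h) \<longlongrightarrow> d) (at_right 0)" by blast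
  qed
qed

text \<open>Blow up \<open>F\<close> at \<open>x\<close>. A normal limit is linear on the positive axis, hence linear, by extending
  the difference by \<open>0\<close> across the axis.\<close>

lemma derivative_boundary_limit:
  fixes x :: real
  assumes lip: "C-lipschitz_on {z. 0 \<le> Im z} F" and hol: "F holomorphic_on {z. 0 < Im z}"
    and right: "((\<lambda>h. (F (of_real (x + h)) - F (of_real x)) / of_real h) \<longlongrightarrow> D) (at_right 0)"
  shows "((\<lambda>t. deriv F (Complex x t)) \<longlongrightarrow> D) (at_right 0)"
proof (rule ccontr)
  define S where "S = {z. 0 < Im z}"
  have o: "open S" unfolding S_def by (rule open_halfspace_Im_gt)
  have C: "0 \<le> C" using lip by (rule lipschitz_on_nonneg)
  assume "\<not> ?thesis"
  then obtain e where e: "0 < e" "\<not> (\<forall>\<^sub>F t in at_right 0. dist (deriv F (Complex x t)) D < e)"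
    by (auto simp: tendsto_iff)
  have "\<exists>t. 0 < t \<and> t < inverse (real (Suc n)) \<and> e \<le> dist (deriv F (Complex x t)) D" for n
    using e(2) unfolding eventually_at_right_field
    by (meson inverse_positive_iff_positive not_less of_nat_0_less_iff zero_less_Suc)
  then obtain T where T: "\<And>n. 0 < T n" "\<And>n. T n < inverse (real (Suc n))"
    "\<And>n. e \<le> dist (deriv F (Complex x (T n))) D" by metis
  have T0: "T \<longlonglongrightarrow> 0"
    by (rule tendsto_sandwich [OF _ _ tendsto_const LIMSEQ_inverse_real_of_nat])
      (use T in \<open>auto intro: less_imp_le always_eventually\<close>)
  \<comment> \<open>The rescalings vanish at 0 and share the Lipschitz constant \<open>C\<close>, so
    they form a normal family. The derivative of \<open>E n\<close> at \<i> is that of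
    \<open>F\<close> at height \<open>T n\<close> above \<open>x\<close>.\<close>
  define E where "E n z = (F (of_real x + T n * z) - F (of_real x)) / T n" for n and z :: complex
  have Elip: "cmod (E n z - E n w) \<le> C * cmod (z - w)" if "0 \<le> Im z" "0 \<le> Im w" for n and z w :: complex
  proof -
    have "cmod (F (of_real x + T n * z) - F (of_real x + T n * w)) \<le> C * cmod ((of_real x + T n * z) - (of_real x + T n * w))"
      using lipschitz_onD [OF lip, of "of_real x + T n * z" "of_real x + T n * w"] that T(1) [of n]
      by (simp add: dist_norm)
    also have "(of_real x + T n * z) - (of_real x + T n * w) = T n * (z - w)"
      by (simp add: algebra_simps)
    also have "C * cmod (T n * (z - w)) = T n * (C * cmod (z - w))"
      using T(1) [of n] by (simp add: norm_mult)
    finally have "cmod (F (of_real x + T n * z) - F (of_real x + T n * w)) / T n \<le> C * cmod (z - w)"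
      using T(1) [of n] by (simp add: pos_divide_le_eq mult.commute)
    moreover have "E n z - E n w = (F (of_real x + T n * z) - F (of_real x + T n * w)) / T n"
      by (simp add: E_def diff_divide_distrib)
    ultimately show ?thesis
      using T(1) [of n] by (simp add: norm_divide)
  qed
  have E0: "E n 0 = 0" for n by (simp add: E_def)
  have E': "(E n has_field_derivative deriv F (of_real x + T n * z)) (at z)" if "z \<in> S" for n and z :: complex
  proof -
    have 1: "(F has_field_derivative deriv F (of_real x + T n * z)) (at (of_real x + T n * z))"
      using that T(1) [of n] o by (intro holomorphic_derivI [OF hol]) (auto simp: S_def)
    have 2: "((\<lambda>z. of_real x + of_real (T n) * z) has_field_derivative of_real (T n)) (at z)"
      by (auto intro!: derivative_eq_intros)
    from DERIV_cdivide [OF DERIV_diff [OF DERIV_chain2 [OF 1 2] DERIV_const], of "F (of_real x)" "of_real (T n)"] show ?thesis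
      using T(1) [of n] by (simp add: E_def [abs_def])
  qed
  define H where "H = {h. h holomorphic_on S \<and> (\<forall>z\<in>S. cmod (h z) \<le> C * cmod z)}"
  obtain G r where G: "G holomorphic_on S" "strict_mono (r :: nat \<Rightarrow> nat)"
    "\<And>z. z \<in> S \<Longrightarrow> (\<lambda>n. E (r n) z) \<longlonglongrightarrow> G z"
    "\<And>K. \<lbrakk>compact K; K \<subseteq> S\<rbrakk> \<Longrightarrow> uniform_limit K (E \<circ> r) G sequentially"
  proof (rule Montel [OF o])
    show "h holomorphic_on S" if "h \<in> H" for h using that by (simp add: H_def)
    show "\<exists>B. \<forall>h\<in>H. \<forall>z\<in>K. cmod (h z) \<le> B" if K: "compact K" "K \<subseteq> S" for K
    proof -
      obtain b where "\<And>z. z \<in> K \<Longrightarrow> cmod z \<le> b"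
        using compact_imp_bounded [OF K(1)] by (auto simp: bounded_iff)
      then have "cmod (h z) \<le> C * b" if "h \<in> H" "z \<in> K" for h z
        using that K C by (auto simp: H_def intro!: order_trans [OF _ mult_left_mono [of "cmod z" b C]])
      then show ?thesis by blast
    qed
    show "range E \<subseteq> H"
      using E' Elip [of _ 0] E0 by (auto simp: H_def S_def holomorphic_on_open [OF o [unfolded S_def]])
  qed blast
  have "(\<lambda>n. deriv ((E \<circ> r) n) \<i>) \<longlonglongrightarrow> deriv G \<i>"
  proof (rule deriv_complex_uniform_limit)
    have "z \<in> S" if "dist \<i> z \<le> 1/2" for z
      using that abs_Im_le_cmod [of "\<i> - z"] by (simp add: S_def dist_norm)
    then have "cball \<i> (1/2) \<subseteq> S" by auto
    then have "uniform_limit (cball \<i> (1/2)) (E \<circ> r) G sequentially" by (intro G(4)) auto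
    then show "uniform_limit (ball \<i> (1/2)) (E \<circ> r) G sequentially"
      by (rule uniform_limit_on_subset) auto
    show "\<forall>\<^sub>F n in sequentially. (E \<circ> r) n holomorphic_on ball \<i> (1/2)"
    proof (intro always_eventually allI)
      fix n
      have "E (r n) holomorphic_on S" using E' by (auto simp: holomorphic_on_open [OF o])
      then show "(E \<circ> r) n holomorphic_on ball \<i> (1/2)"
        using holomorphic_on_subset [OF _ order_trans [OF ball_subset_cball \<open>cball \<i> (1/2) \<subseteq> S\<close>]]
        by (simp add: o_def)
    qed
  qed auto
  moreover have "deriv ((E \<circ> r) n) \<i> = deriv F (Complex x (T (r n)))" for n
  proof -
    have "of_real x + T (r n) * \<i> = Complex x (T (r n))" by (simp add: complex_eq_iff)
    then show ?thesis using DERIV_imp_deriv [OF E' [of \<i> "r n"]] by (simp add: S_def)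
  qed
  ultimately have lim1: "(\<lambda>n. deriv F (Complex x (T (r n)))) \<longlonglongrightarrow> deriv G \<i>" by simp
  \<comment> \<open>Compare \<open>z\<close> with its foot \<open>Re z\<close> at distance
    \<open>Im z\<close>: there the rescalings tend to \<open>D * Re z\<close>. The restriction to
    \<open>Re z > 0\<close> reflects that only a right derivative is given.\<close>
  have bound: "cmod (G z - D * z) \<le> (C + cmod D) * Im z" if z: "0 < Im z" "0 < Re z" for z
  proof -
    have "filterlim (\<lambda>n. T (r n) * Re z) (at_right 0) sequentially"
    proof (rule tendsto_imp_filterlim_at_right)
      have "(\<lambda>n. T (r n) * Re z) \<longlonglongrightarrow> 0 * Re z"
        using LIMSEQ_subseq_LIMSEQ [OF T0 G(2)] by (intro tendsto_intros) (simp add: o_def)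
      then show "(\<lambda>n. T (r n) * Re z) \<longlonglongrightarrow> 0" by simp
    qed (use T z in auto)
    from filterlim_compose [OF right this]
    have "(\<lambda>n. (F (of_real (x + T (r n) * Re z)) - F (of_real x)) / of_real (T (r n) * Re z) * Re z) \<longlonglongrightarrow> D * Re z"
      by (intro tendsto_intros)
    moreover have "(F (of_real (x + T (r n) * Re z)) - F (of_real x)) / of_real (T (r n) * Re z) * Re z = E (r n) (Re z)" for n
      using z by (simp add: E_def)
    ultimately have "(\<lambda>n. E (r n) (Re z)) \<longlonglongrightarrow> D * Re z" by simp
    then have "(\<lambda>n. cmod (E (r n) z - E (r n) (Re z))) \<longlonglongrightarrow> cmod (G z - D * Re z)"
      using z by (intro tendsto_intros G) (auto simp: S_def)
    then have "cmod (G z - D * Re z) \<le> C * Im z"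
    proof (rule tendsto_upperbound)
      have "cmod (z - Re z) = Im z" using z by (simp add: cmod_def)
      then show "\<forall>\<^sub>F n in sequentially. cmod (E (r n) z - E (r n) (Re z)) \<le> C * Im z"
        using Elip [of z "Re z"] z by (auto intro!: always_eventually)
    qed simp
    moreover have "G z - D * z = (G z - D * Re z) - D * (\<i> * Im z)"
      by (subst (2) complex_eq [of z]) (simp add: algebra_simps)
    then have "cmod (G z - D * z) \<le> cmod (G z - D * Re z) + cmod (D * (\<i> * Im z))"
      by (simp only: norm_triangle_ineq4)
    ultimately show ?thesis using z by (simp add: norm_mult algebra_simps)
  qed
  define g where "g z = (if 0 < Im z then G z - D * z else 0)" for z
  have hol1: "(\<lambda>z. G z - D * z) holomorphic_on S" by (intro holomorphic_intros G)
  have holg: "g holomorphic_on {z. 0 < Re z}"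
  proof (rule holomorphic_on_paste_across_line [where d = \<i> and k = 0])
    show "open {z. 0 < Re z}" by (rule open_halfspace_Re_gt)
    show "g holomorphic_on {z. 0 < Re z} \<inter> {z. \<i> \<bullet> z < 0}"
      by (rule holomorphic_transform [of "\<lambda>z. 0"]) (auto simp: g_def inner_complex_def)
    show "g holomorphic_on {z. 0 < Re z} \<inter> {z. 0 < \<i> \<bullet> z}"
      by (rule holomorphic_transform [OF holomorphic_on_subset [OF hol1]]) (auto simp: g_def S_def inner_complex_def)
    show "continuous_on {z. 0 < Re z} g"
    proof (intro continuous_at_imp_continuous_on ballI)
      fix z assume "z \<in> {z. 0 < Re z}"
      then have z: "0 < Re z" by simp
      show "isCont g z"
      proof (cases "0 < Im z")
        case True
        have "isCont (\<lambda>z. G z - D * z) z"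
          using True o by (intro continuous_on_interior [OF holomorphic_on_imp_continuous_on [OF hol1]]) (simp add: S_def interior_open)
        moreover have "\<forall>\<^sub>F w in nhds z. g w = G w - D * w"
          using eventually_nhds_in_open [OF o, of z] True by (auto simp: S_def g_def elim!: eventually_mono)
        ultimately show ?thesis by (simp add: isCont_cong)
      next
        case False
        have "((\<lambda>w. (C + cmod D) * (\<bar>Im w - Im z\<bar>)) \<longlongrightarrow> (C + cmod D) * \<bar>Im z - Im z\<bar>) (at z)"
          by (intro tendsto_intros)
        then have lim0: "((\<lambda>w. (C + cmod D) * (\<bar>Im w - Im z\<bar>)) \<longlongrightarrow> 0) (at z)" by simp
        have "\<forall>\<^sub>F w in at z. w \<in> {z. 0 < Re z}"
          using z by (intro eventually_at_in_open' open_halfspace_Re_gt) auto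
        then have "\<forall>\<^sub>F w in at z. cmod (g w) \<le> (C + cmod D) * (\<bar>Im w - Im z\<bar>)"
        proof eventually_elim
          case (elim w)
          show ?case
          proof (cases "0 < Im w")
            case True
            then have "cmod (g w) \<le> (C + cmod D) * Im w" using bound elim by (simp add: g_def)
            also have "\<dots> \<le> (C + cmod D) * (\<bar>Im w - Im z\<bar>)"
              using False True C by (intro mult_left_mono) auto
            finally show ?thesis .
          qed (use C in \<open>simp add: g_def\<close>)
        qed
        then have "(g \<longlongrightarrow> 0) (at z)" by (rule Lim_null_comparison [OF _ lim0])
        then show ?thesis using False by (simp add: isCont_def g_def)
      qed
    qed
  qed auto
  have gz: "g z = 0" if "z \<in> {z. 0 < Re z}" for z
  proof (rule analytic_continuation_open [where f = g and g = "\<lambda>z. 0" and s = "{z. 0 < Re z} \<inter> {z. Im z < 0}" and s' = "{z. 0 < Re z}"])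
    show "open ({z. 0 < Re z} \<inter> {z. Im z < 0})"
      by (intro open_Int open_halfspace_Re_gt open_halfspace_Im_lt)
    show "connected {z. 0 < Re z}" by (intro convex_connected convex_halfspace_Re_gt)
    have "Complex 1 (-1) \<in> {z. 0 < Re z} \<inter> {z. Im z < 0}" by simp
    then show "{z. 0 < Re z} \<inter> {z. Im z < 0} \<noteq> {}" by blast
    show "g w = 0" if "w \<in> {z. 0 < Re z} \<inter> {z. Im z < 0}" for w using that by (simp add: g_def)
  qed (use that holg in \<open>simp_all add: open_halfspace_Re_gt\<close>)
  have quad: "G z = D * z" if "0 < Re z" "0 < Im z" for z
  proof -
    have "g z = 0" using that gz by simp
    then show ?thesis using that by (simp add: g_def)
  qed
  \<comment> \<open>The identity theorem carries the linear formula from the quadrant to the whole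
    half-plane, in particular to \<i>.\<close>
  have Glin: "G z = D * z" if "z \<in> S" for z
  proof (rule analytic_continuation_open [where f = G and g = "\<lambda>z. D * z" and s = "{z. 0 < Re z} \<inter> S" and s' = S])
    show "open ({z. 0 < Re z} \<inter> S)" by (intro open_Int open_halfspace_Re_gt o)
    show "connected S" unfolding S_def by (intro convex_connected convex_halfspace_Im_gt)
    have "Complex 1 1 \<in> {z. 0 < Re z} \<inter> S" by (simp add: S_def)
    then show "{z. 0 < Re z} \<inter> S \<noteq> {}" by blast
    show "G w = D * w" if "w \<in> {z. 0 < Re z} \<inter> S" for w
      using that by (intro quad) (simp_all add: S_def)
    show "(\<lambda>z. D * z) holomorphic_on S" by (intro holomorphic_intros)
  qed (use that G(1) o in simp_all)
  have "deriv G \<i> = D"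
  proof (rule DERIV_imp_deriv)
    have "((\<lambda>z. D * z) has_field_derivative D) (at \<i>)"
      by (auto intro!: derivative_eq_intros)
    then show "(G has_field_derivative D) (at \<i>)"
      by (rule has_field_derivative_transform_within_open [OF _ o]) (simp_all add: Glin, simp add: S_def)
  qed
  then have "\<forall>\<^sub>F n in sequentially. dist (deriv F (Complex x (T (r n)))) D < e"
    using tendstoD [OF lim1 e(1)] by simp
  then obtain n where "dist (deriv F (Complex x (T (r n)))) D < e"
    using eventually_happens' [OF sequentially_bot] by blast
  with T(3) [of "r n"] show False by simp
qed

text \<open>In the coordinate \<open>exp (\<i> * z)\<close> the function is the derivative of a
  primitive that is Lipschitz because the function is bounded, and so extends to the real line. The
  extension has a right derivative at almost every real point, and
  \<open>derivative_boundary_limit\<close> turns it into a vertical limit, which is a radial one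
  with \<open>t = exp (- y)\<close>.\<close>

lemma fatou_radial_limits:
  assumes hol: "\<phi> holomorphic_on ball 0 1" and bdd: "\<And>z. cmod z < 1 \<Longrightarrow> cmod (\<phi> z) \<le> C"
  shows "AE x in lborel. \<exists>l. ((\<lambda>t. \<phi> (of_real t * cis x)) \<longlongrightarrow> l) (at_left 1)"
proof -
  define S where "S = {z. 0 < Im z}"
  have o: "open S" unfolding S_def by (rule open_halfspace_Im_gt)
  have C: "0 \<le> C" using bdd [of 0] norm_ge_zero [of "\<phi> 0"] by (simp del: norm_ge_zero)
  have E1: "exp (\<i> * z) \<in> ball 0 1" if "z \<in> S" for z
    using that by (simp add: S_def norm_exp_eq_Re)
  have holE: "(\<lambda>z. \<phi> (exp (\<i> * z))) holomorphic_on S"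
  proof -
    have "(\<lambda>z. exp (\<i> * z)) holomorphic_on S" by (intro holomorphic_intros)
    moreover have "(\<lambda>z. exp (\<i> * z)) ` S \<subseteq> ball 0 1" using E1 by blast
    ultimately show ?thesis
      using holomorphic_on_compose_gen [OF _ hol, of "\<lambda>z. exp (\<i> * z)" S] by (simp add: o_def)
  qed
  obtain F0 where F0: "\<And>z. 0 < Im z \<Longrightarrow> (F0 has_field_derivative \<phi> (exp (\<i> * z))) (at z)"
    using halfplane_primitive [OF holE [unfolded S_def]] by blast
  have "C-lipschitz_on S F0"
  proof (rule lipschitz_onI [OF _ C])
    fix z w assume zw: "z \<in> S" "w \<in> S"
    have "cmod (F0 z - F0 w) \<le> C * cmod (z - w)"
    proof (rule field_differentiable_bound [where S = S and f' = "\<lambda>z. \<phi> (exp (\<i> * z))"])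
      show "convex S" unfolding S_def by (rule convex_halfspace_Im_gt)
      fix u assume u: "u \<in> S"
      show "(F0 has_field_derivative \<phi> (exp (\<i> * u))) (at u within S)"
        using u by (intro has_field_derivative_at_within [OF F0]) (simp add: S_def)
      show "cmod (\<phi> (exp (\<i> * u))) \<le> C" using E1 [OF u] by (intro bdd) simp
    qed (use zw in auto)
    then show "dist (F0 z) (F0 w) \<le> C * dist z w" by (simp add: dist_norm)
  qed
  then obtain F where F: "C-lipschitz_on (closure S) F" "\<And>z. z \<in> S \<Longrightarrow> F z = F0 z"
    using lipschitz_extend_closure by metis
  have "closure S = {z. 0 \<le> Im z}"
    using closure_halfspace_gt [of \<i> 0] by (simp add: S_def inner_complex_def)
  then have lip: "C-lipschitz_on {z. 0 \<le> Im z} F" using F(1) by simp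
  have F': "(F has_field_derivative \<phi> (exp (\<i> * z))) (at z)" if "z \<in> S" for z
    using F(2) that by (intro has_field_derivative_transform_within_open [OF F0 o]) (auto simp: S_def)
  have holF: "F holomorphic_on {z. 0 < Im z}"
    using F' by (auto simp: S_def holomorphic_on_open open_halfspace_Im_gt)
  have lipR: "C-lipschitz_on UNIV (\<lambda>x. Re (F (of_real x)))" "C-lipschitz_on UNIV (\<lambda>x. Im (F (of_real x)))"
  proof -
    have *: "cmod (F (of_real x) - F (of_real y)) \<le> C * \<bar>x - y\<bar>" for x y
      using lipschitz_onD [OF lip, of "of_real x" "of_real y"]
      by (simp add: dist_norm flip: of_real_diff)
    show "C-lipschitz_on UNIV (\<lambda>x. Re (F (of_real x)))"
      by (rule lipschitz_onI [OF _ C])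
        (use order_trans [OF abs_Re_le_cmod *] in \<open>simp add: dist_real_def\<close>)
    show "C-lipschitz_on UNIV (\<lambda>x. Im (F (of_real x)))"
      by (rule lipschitz_onI [OF _ C])
        (use order_trans [OF abs_Im_le_cmod *] in \<open>simp add: dist_real_def\<close>)
  qed
  obtain N1 where N1: "negligible N1" "\<And>x. x \<notin> N1 \<Longrightarrow>
     \<exists>d. ((\<lambda>h. (Re (F (of_real (x + h))) - Re (F (of_real x))) / h) \<longlongrightarrow> d) (at_right 0)"
    using lipschitz_real_right_derivative_ae [OF lipR(1)] by blast
  obtain N2 where N2: "negligible N2" "\<And>x. x \<notin> N2 \<Longrightarrow>
     \<exists>d. ((\<lambda>h. (Im (F (of_real (x + h))) - Im (F (of_real x))) / h) \<longlongrightarrow> d) (at_right 0)"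
    using lipschitz_real_right_derivative_ae [OF lipR(2)] by blast
  have lim: "\<exists>l. ((\<lambda>t. \<phi> (of_real t * cis x)) \<longlongrightarrow> l) (at_left 1)" if x: "x \<notin> N1 \<union> N2" for x
  proof -
    obtain d1 d2 where d:
      "((\<lambda>h. (Re (F (of_real (x + h))) - Re (F (of_real x))) / h) \<longlongrightarrow> d1) (at_right 0)"
      "((\<lambda>h. (Im (F (of_real (x + h))) - Im (F (of_real x))) / h) \<longlongrightarrow> d2) (at_right 0)"
      using N1(2) N2(2) x by blast
    have "((\<lambda>h. (F (of_real (x + h)) - F (of_real x)) / of_real h) \<longlongrightarrow> Complex d1 d2) (at_right 0)"
      using d by (simp add: tendsto_complex_iff Re_divide_of_real Im_divide_of_real)
    from derivative_boundary_limit [OF lip holF this]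
    have "((\<lambda>t. deriv F (Complex x t)) \<longlongrightarrow> Complex d1 d2) (at_right 0)" .
    moreover have "filterlim (\<lambda>s. - ln s) (at_right 0) (at_left (1::real))"
      by real_asymp
    ultimately have "((\<lambda>s. deriv F (Complex x (- ln s))) \<longlongrightarrow> Complex d1 d2) (at_left 1)"
      by (rule filterlim_compose)
    moreover have "\<forall>\<^sub>F s in at_left 1. deriv F (Complex x (- ln s)) = \<phi> (of_real s * cis x)"
    proof -
      have "\<forall>\<^sub>F s in at_left 1. s \<in> {0<..<1::real}"
        by (intro eventually_at_left_real) auto
      then show ?thesis
      proof eventually_elim
        case (elim s)
        then have "Complex x (- ln s) \<in> S" by (simp add: S_def)
        moreover have "exp (\<i> * Complex x (- ln s)) = of_real s * cis x"
          using elim by (simp add: cis_exp_Complex)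
        ultimately show ?case using DERIV_imp_deriv [OF F'] by simp
      qed
    qed
    ultimately show ?thesis by (auto simp: tendsto_cong)
  qed
  have "negligible (N1 \<union> N2)" using N1 N2 by (simp add: negligible_Un)
  then have "AE x in lebesgue. x \<notin> N1 \<union> N2"
    by (simp only: negligible_iff_null_sets AE_not_in)
  then have "AE x in lebesgue. \<exists>l. ((\<lambda>t. \<phi> (of_real t * cis x)) \<longlongrightarrow> l) (at_left 1)"
    by (rule eventually_mono) (rule lim)
  then show ?thesis by (simp add: AE_completion_iff)
qed

section \<open>Mean values, measurability of radial limits and the centre of a leaf\<close>

text \<open>Cauchy's integral formula on the circle of radius \<open>r\<close>; the half-open
  interval is the one used in \<open>arc_length_measure\<close>.\<close>

lemma holomorphic_mean_value:
  fixes \<phi> :: "complex \<Rightarrow> complex"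
  assumes hol: "\<phi> holomorphic_on ball 0 1" and r: "0 < r" "r < 1"
  shows "integral\<^sup>L (restrict_space lborel {0..<2*pi}) (\<lambda>x. \<phi> (of_real r * cis x)) = 2 * pi * \<phi> 0"
proof -
  have sub: "cball 0 r \<subseteq> ball (0::complex) 1" using r by auto
  have "((\<lambda>u. \<phi> u / (u - 0)) has_contour_integral (2 * of_real pi * \<i> * \<phi> 0)) (circlepath 0 r)"
    by (rule Cauchy_integral_circlepath_simple) (use r sub hol in \<open>auto intro: holomorphic_on_subset\<close>)
  then have "((\<lambda>t. \<phi> (0 + r * cis t) / (0 + r * cis t - 0) * r * \<i> * cis t) has_integral 2 * of_real pi * \<i> * \<phi> 0) {0..2*pi}"
    unfolding circlepath_def by (subst (asm) has_contour_integral_part_circlepath_iff) auto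
  then have "((\<lambda>t. \<i> * \<phi> (r * cis t)) has_integral \<i> * (2 * pi * \<phi> 0)) {0..2*pi}"
    by (rule has_integral_eq_rhs [OF has_integral_eq [rotated]]) (use r in \<open>auto simp: field_simps\<close>)
  then have "((\<lambda>t. (- \<i>) * (\<i> * \<phi> (r * cis t))) has_integral (- \<i>) * (\<i> * (2 * pi * \<phi> 0))) {0..2*pi}"
    by (rule has_integral_mult_right)
  then have closed: "((\<lambda>t. \<phi> (r * cis t)) has_integral 2 * pi * \<phi> 0) {0..2*pi}"
    by (simp flip: mult.assoc)
  have "((\<lambda>t. \<phi> (r * cis t)) has_integral 2 * pi * \<phi> 0) {0..<2*pi}"
  proof (subst has_integral_spike_set_eq [of _ "{0..2*pi}"])
    show "negligible {x \<in> {0..<2 * pi} - {0..2 * pi}. \<phi> (r * cis x) \<noteq> 0}"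
      by (rule negligible_subset [of "{}"]) auto
    show "negligible {x \<in> {0..2 * pi} - {0..<2 * pi}. \<phi> (r * cis x) \<noteq> 0}"
      by (rule negligible_subset [of "{2 * pi}"]) auto
  qed (rule closed)
  then have I: "integral {0..<2*pi} (\<lambda>t. \<phi> (r * cis t)) = 2 * pi * \<phi> 0" by (rule integral_unique)
  have "continuous_on {0..2*pi} (\<lambda>t. \<phi> (r * cis t))"
    by (rule continuous_on_compose2 [OF holomorphic_on_imp_continuous_on [OF hol]])
      (use r in \<open>auto intro!: continuous_intros simp: norm_mult\<close>)
  then have "set_integrable lborel {0..2*pi} (\<lambda>t. \<phi> (r * cis t))"
    unfolding set_integrable_def by (intro borel_integrable_compact) auto
  then have "set_integrable lborel {0..<2*pi} (\<lambda>t. \<phi> (r * cis t))"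
    by (rule set_integrable_subset) auto
  from set_borel_integral_eq_integral(2) [OF this] I show ?thesis
    by (simp add: integral_restrict_space set_lebesgue_integral_def)
qed

text \<open>Countable quantifiers over \<open>m\<close> and \<open>N\<close> stand outside and the
  inequality is not strict. For functions depending continuously on a parameter, the parameters with
  a limit then form a countable intersection of countable unions of closed sets.\<close>

lemma ex_limit_at_left_iff_Cauchy:
  fixes f :: "real \<Rightarrow> 'a::complete_space"
  shows "(\<exists>l. (f \<longlongrightarrow> l) (at_left 1)) \<longleftrightarrow>
    (\<forall>m. \<exists>N. \<forall>s\<in>{1 - inverse (real (Suc N))<..<1}. \<forall>t\<in>{1 - inverse (real (Suc N))<..<1}.
       dist (f s) (f t) \<le> inverse (real (Suc m)))" (is "?L \<longleftrightarrow> ?R")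
proof
  assume ?L
  then obtain l where l: "(f \<longlongrightarrow> l) (at_left 1)" by blast
  show ?R
  proof
    fix m
    have "\<forall>\<^sub>F s in at_left 1. dist (f s) l < inverse (real (Suc m)) / 2"
      by (rule tendstoD [OF l]) simp
    then obtain b where b: "b < 1" "\<And>s. \<lbrakk>b < s; s < 1\<rbrakk> \<Longrightarrow> dist (f s) l < inverse (real (Suc m)) / 2"
      by (auto simp: eventually_at_left_field)
    obtain N where N: "inverse (real (Suc N)) < 1 - b"
      using reals_Archimedean [of "1 - b"] b(1) by auto
    have "dist (f s) (f t) \<le> inverse (real (Suc m))"
      if "s \<in> {1 - inverse (real (Suc N))<..<1}" "t \<in> {1 - inverse (real (Suc N))<..<1}" for s t
    proof -
      have "b < s" "s < 1" "b < t" "t < 1" using that N by auto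
      then have "dist (f s) l < inverse (real (Suc m)) / 2" "dist (f t) l < inverse (real (Suc m)) / 2"
        using b(2) by blast+
      then show ?thesis
        using dist_triangle_half_r [of l "f s" "inverse (real (Suc m))" "f t"] by (simp add: dist_commute less_imp_le)
    qed
    then show "\<exists>N. \<forall>s\<in>{1 - inverse (real (Suc N))<..<1}. \<forall>t\<in>{1 - inverse (real (Suc N))<..<1}.
       dist (f s) (f t) \<le> inverse (real (Suc m))" by blast
  qed
next
  assume R: ?R
  have "cauchy_filter (filtermap f (at_left 1))"
    unfolding cauchy_filter_metric_filtermap
  proof (intro allI impI)
    fix e :: real assume "0 < e"
    then obtain m where m: "inverse (real (Suc m)) < e" using reals_Archimedean by blast
    obtain N where N: "\<And>s t. \<lbrakk>s \<in> {1 - inverse (real (Suc N))<..<1}; t \<in> {1 - inverse (real (Suc N))<..<1}\<rbrakk>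
       \<Longrightarrow> dist (f s) (f t) \<le> inverse (real (Suc m))" using R by blast
    have "\<forall>\<^sub>F s in at_left 1. s \<in> {1 - inverse (real (Suc N))<..<1}"
      by (intro eventually_at_left_real) simp
    then show "\<exists>P. eventually P (at_left 1) \<and> (\<forall>x y. P x \<and> P y \<longrightarrow> dist (f x) (f y) < e)"
      using N m by (intro exI [of _ "\<lambda>s. s \<in> {1 - inverse (real (Suc N))<..<1}"]) (meson le_less_trans)
  qed
  then show ?L
    using cauchy_filter_complete_converges [of "filtermap f (at_left 1)" UNIV]
    by (auto simp: complete_UNIV filterlim_def filtermap_bot_iff)
qed

text \<open>Measurability concerns the total function, including the value of \<open>Lim\<close>
  where no limit exists: on the Borel set where the limit exists it is a sequential limit of
  continuous functions, and elsewhere it is constant.\<close>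

lemma radial_limit_measurable:
  fixes f :: "complex \<Rightarrow> complex^'n"
  assumes f: "holomorphic_map f"
  shows "radial_limit f \<in> borel_measurable (restrict_space borel (sphere 0 1))"
proof -
  define M where "M = restrict_space (borel :: complex measure) (sphere 0 1)"
  have cont: "continuous_on (ball 0 1) f"
  proof -
    have "continuous_on (ball 0 1) (\<lambda>z. f z $ i)" for i
      using f by (intro holomorphic_on_imp_continuous_on) (simp add: holomorphic_map_def)
    then show ?thesis
      unfolding continuous_on_def by (blast intro: vec_tendstoI)
  qed
  have contr: "continuous_on (sphere 0 1) (\<lambda>\<zeta>. f (of_real s * \<zeta>))" if "0 \<le> s" "s < 1" for s
    by (rule continuous_on_compose2 [OF cont]) (use that in \<open>auto intro!: continuous_intros simp: norm_mult\<close>)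
  define I where "I N = {1 - inverse (real (Suc N))<..<1}" for N
  have I: "0 \<le> s" "s < 1" if "s \<in> I N" for s N
  proof -
    have "inverse (real (Suc N)) \<le> 1" by (simp add: inverse_le_1_iff)
    then show "0 \<le> s" "s < 1" using that by (auto simp: I_def simp del: of_nat_Suc)
  qed
  define A where "A m N = {\<zeta> \<in> sphere 0 1. \<forall>s\<in>I N. \<forall>t\<in>I N.
      dist (f (of_real s * \<zeta>)) (f (of_real t * \<zeta>)) \<le> inverse (real (Suc m))}" for m N
  \<comment> \<open>For fixed \<open>s\<close> and \<open>t\<close> the condition is closed in
    \<zeta>, so the intersection over uncountably many pairs does no harm.\<close>
  have closedA: "closed (A m N)" for m N
  proof -
    have "closed {\<zeta> \<in> sphere 0 1. dist (f (of_real s * \<zeta>)) (f (of_real t * \<zeta>)) \<le> inverse (real (Suc m))}"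
      if "s \<in> I N" "t \<in> I N" for s t
      using that I by (intro continuous_on_closed_Collect_le continuous_intros contr) auto
    moreover have "A m N = sphere 0 1 \<inter> (\<Inter>s\<in>I N. \<Inter>t\<in>I N.
       {\<zeta> \<in> sphere 0 1. dist (f (of_real s * \<zeta>)) (f (of_real t * \<zeta>)) \<le> inverse (real (Suc m))})"
      by (auto simp: A_def)
    ultimately show ?thesis by (auto intro!: closed_Int closed_INT)
  qed
  define E where "E = (\<Inter>m. \<Union>N. A m N)"
  have "E \<in> sets borel"
    unfolding E_def using closedA by (intro sets.countable_INT'' sets.countable_UN) auto
  have E: "\<zeta> \<in> E \<longleftrightarrow> (\<exists>l. ((\<lambda>t. f (of_real t * \<zeta>)) \<longlongrightarrow> l) (at_left 1))" if "\<zeta> \<in> sphere 0 1" for \<zeta>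
    using that unfolding ex_limit_at_left_iff_Cauchy by (auto simp: E_def A_def I_def)
  have E_meas: "E \<in> sets M"
  proof -
    have "E \<subseteq> sphere 0 1" by (auto simp: E_def A_def)
    then show ?thesis using \<open>E \<in> sets borel\<close> by (simp add: M_def sets_restrict_space_iff)
  qed
  define r where "r n = 1 - inverse (real (Suc n))" for n
  have r: "0 \<le> r n" "r n < 1" for n
    using inverse_le_1_iff [of "real (Suc n)"] by (auto simp: r_def simp del: of_nat_Suc)
  have r_lim: "filterlim r (at_left 1) sequentially"
  proof (rule tendsto_imp_filterlim_at_left)
    have "(\<lambda>n. 1 - inverse (real (Suc n))) \<longlonglongrightarrow> 1 - 0"
      by (intro tendsto_intros LIMSEQ_inverse_real_of_nat)
    then show "r \<longlonglongrightarrow> 1" by (simp add: r_def [abs_def])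
  qed (use r in auto)
  have [measurable]: "(\<lambda>\<zeta>. f (of_real (r n) * \<zeta>)) \<in> borel_measurable M" for n
    unfolding M_def by (intro borel_measurable_continuous_on_restrict contr r)
  have [measurable]: "(\<lambda>\<zeta>. lim (\<lambda>n. f (of_real (r n) * \<zeta>))) \<in> borel_measurable M"
    by measurable
  \<comment> \<open>\<open>THE l. False\<close> is the unspecified value to which \<open>Lim\<close>
    reduces when no limit exists; it is the same at every such point.\<close>
  have "(\<lambda>\<zeta>. if \<zeta> \<in> E then lim (\<lambda>n. f (of_real (r n) * \<zeta>)) else (THE l. False)) \<in> borel_measurable M"
    using E_meas by measurable
  moreover have "radial_limit f \<zeta> = (if \<zeta> \<in> E then lim (\<lambda>n. f (of_real (r n) * \<zeta>)) else (THE l. False))"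
    if "\<zeta> \<in> space M" for \<zeta>
  proof -
    have "\<zeta> \<in> sphere 0 1" using that by (simp add: M_def space_restrict_space)
    note E = E [OF this]
    show ?thesis
    proof (cases "\<zeta> \<in> E")
    case True
    then obtain l where l: "((\<lambda>t. f (of_real t * \<zeta>)) \<longlongrightarrow> l) (at_left 1)"
      using E by blast
    then have "radial_limit f \<zeta> = l" unfolding radial_limit_def by (intro tendsto_Lim) auto
    moreover have "(\<lambda>n. f (of_real (r n) * \<zeta>)) \<longlonglongrightarrow> l"
      by (rule filterlim_compose [OF l r_lim])
    ultimately show ?thesis using True by (simp add: limI)
  next
    case False
    then have "\<not> ((\<lambda>t. f (of_real t * \<zeta>)) \<longlongrightarrow> l) (at_left 1)" for l
      using E by blast
    then show ?thesis using False by (simp add: radial_limit_def t2_space_class.Lim_def)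
    qed
  qed
  ultimately show ?thesis unfolding M_def [symmetric] by (simp cong: measurable_cong)
qed

lemma scale_measure_eq_density: "scale_measure r M = density M (\<lambda>_. r)"
  by (rule measure_eqI) (auto simp: emeasure_density_const)

lemma cis_measurable_circle:
  "cis \<in> measurable (restrict_space lborel {0..<2*pi}) (restrict_space borel (sphere 0 1))"
proof (rule measurable_restrict_space2)
  have "cis \<in> borel_measurable borel"
    by (intro borel_measurable_continuous_onI continuous_intros)
  then show "cis \<in> borel_measurable (restrict_space lborel {0..<2*pi})"
    by (intro measurable_restrict_space1) simp
qed auto

lemma integral_holomorphic_measure:
  fixes f :: "complex \<Rightarrow> complex^'n" and \<psi> :: "complex^'n \<Rightarrow> 'a::{banach, second_countable_topology}"
  assumes f: "holomorphic_map f" and [measurable]: "\<psi> \<in> borel_measurable borel"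
  shows "integral\<^sup>L (holomorphic_measure f) \<psi> =
    (1 / (2 * pi)) *\<^sub>R integral\<^sup>L (restrict_space lborel {0..<2*pi}) (\<lambda>x. \<psi> (radial_limit f (cis x)))"
proof -
  note radial_limit_measurable [OF f, measurable]
  note cis_measurable_circle [measurable]
  have "integral\<^sup>L (holomorphic_measure f) \<psi> =
     integral\<^sup>L (density (distr arc_length_measure borel (radial_limit f)) (\<lambda>_. ennreal (1 / (2 * pi)))) \<psi>"
    by (simp add: holomorphic_measure_def scale_measure_eq_density)
  also have "\<dots> = (1 / (2 * pi)) *\<^sub>R integral\<^sup>L (distr arc_length_measure borel (radial_limit f)) \<psi>"
    by (subst integral_density) auto
  also have "integral\<^sup>L (distr arc_length_measure borel (radial_limit f)) \<psi> =
     integral\<^sup>L arc_length_measure (\<lambda>\<zeta>. \<psi> (radial_limit f \<zeta>))"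
    by (rule integral_distr) (simp_all add: arc_length_measure_def)
  also have "\<dots> = integral\<^sup>L (restrict_space lborel {0..<2*pi}) (\<lambda>x. \<psi> (radial_limit f (cis x)))"
    unfolding arc_length_measure_def by (rule integral_distr) auto
  finally show ?thesis .
qed

text \<open>The mean value property on circles of radius \<open>r n\<close> passes to the boundary
  by dominated convergence, with the constant \<open>C\<close> as dominating function and Fatou's
  theorem for convergence almost everywhere.\<close>

lemma integral_radial_limit:
  fixes f :: "complex \<Rightarrow> complex^'n"
  assumes f: "holomorphic_map f" and bdd: "\<And>z. z \<in> ball 0 1 \<Longrightarrow> norm (f z) \<le> C"
  shows "integrable (restrict_space lborel {0..<2*pi}) (\<lambda>x. radial_limit f (cis x) $ k)"
    and "integral\<^sup>L (restrict_space lborel {0..<2*pi}) (\<lambda>x. radial_limit f (cis x) $ k) = 2 * pi * f 0 $ k"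
proof -
  let ?M = "restrict_space lborel {0..<2*pi} :: real measure"
  note radial_limit_measurable [OF f, measurable]
  note cis_measurable_circle [measurable]
  have holk: "(\<lambda>\<zeta>. f \<zeta> $ i) holomorphic_on ball 0 1" for i
    using f by (simp add: holomorphic_map_def)
  have bddk: "cmod (f z $ i) \<le> C" if "cmod z < 1" for z i
    using that bdd [of z] Finite_Cartesian_Product.norm_nth_le [of "f z" i] by simp
  have "AE x in lborel. \<forall>i\<in>UNIV. \<exists>l. ((\<lambda>t. f (of_real t * cis x) $ i) \<longlongrightarrow> l) (at_left 1)"
    by (intro AE_finite_allI fatou_radial_limits [OF holk bddk]) auto
  then have ex: "AE x in lborel. ((\<lambda>t. f (of_real t * cis x)) \<longlongrightarrow> radial_limit f (cis x)) (at_left 1)"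
  proof eventually_elim
    case (elim x)
    then obtain l where "\<And>i. ((\<lambda>t. f (of_real t * cis x) $ i) \<longlongrightarrow> l i) (at_left 1)" by (auto simp: choice_iff)
    then have lim: "((\<lambda>t. f (of_real t * cis x)) \<longlongrightarrow> (\<chi> i. l i)) (at_left 1)"
      by (intro vec_tendstoI) simp
    moreover have "radial_limit f (cis x) = (\<chi> i. l i)"
      unfolding radial_limit_def by (rule tendsto_Lim [OF _ lim]) simp
    ultimately show ?case by simp
  qed
  \<comment> \<open>The double successor keeps \<open>r n\<close> positive from the start, as the
    mean value property requires.\<close>
  define r where "r n = 1 - inverse (real (Suc (Suc n)))" for n
  have r: "0 < r n" "r n < 1" for n
    by (auto simp: r_def field_simps)
  have r_lim: "filterlim r (at_left 1) sequentially"
  proof (rule tendsto_imp_filterlim_at_left)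
    have "(\<lambda>n. 1 - inverse (real (Suc (Suc n)))) \<longlonglongrightarrow> 1 - 0"
      using LIMSEQ_Suc [OF LIMSEQ_inverse_real_of_nat] by (intro tendsto_intros)
    then show "r \<longlonglongrightarrow> 1" by (simp add: r_def [abs_def])
  qed (use r in auto)
  have s_meas: "(\<lambda>x. f (of_real (r n) * cis x) $ k) \<in> borel_measurable ?M" for n
  proof -
    have "continuous_on UNIV (\<lambda>x. f (of_real (r n) * cis x) $ k)"
      by (rule continuous_on_compose2 [OF holomorphic_on_imp_continuous_on [OF holk]])
        (use r [of n] in \<open>auto intro!: continuous_intros simp: norm_mult\<close>)
    then have "(\<lambda>x. f (of_real (r n) * cis x) $ k) \<in> borel_measurable borel"
      by (rule borel_measurable_continuous_onI)
    then show ?thesis by (intro measurable_restrict_space1) simp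
  qed
  have w: "integrable ?M (\<lambda>x. C)"
  proof -
    have "finite_measure ?M"
      by (intro finite_measureI) (simp add: emeasure_restrict_space space_restrict_space)
    then show ?thesis by (rule finite_measure.integrable_const)
  qed
  have l_meas: "(\<lambda>x. radial_limit f (cis x) $ k) \<in> borel_measurable ?M"
  proof -
    have 1: "(\<lambda>v::complex^'n. v $ k) \<in> borel_measurable borel"
      by (intro borel_measurable_continuous_onI continuous_intros)
    have 2: "(\<lambda>x. radial_limit f (cis x)) \<in> borel_measurable ?M" by measurable
    show ?thesis using measurable_compose [OF 2 1] .
  qed
  have lim: "AE x in ?M. (\<lambda>n. f (of_real (r n) * cis x) $ k) \<longlonglongrightarrow> radial_limit f (cis x) $ k"
  proof -
    have "AE x in lborel. x \<in> {0..<2*pi} \<longrightarrow> (\<lambda>n. f (of_real (r n) * cis x) $ k) \<longlonglongrightarrow> radial_limit f (cis x) $ k"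
      using ex by eventually_elim (auto intro!: tendsto_vec_nth filterlim_compose [OF _ r_lim])
    then show ?thesis by (subst AE_restrict_space_iff) auto
  qed
  have bound: "AE x in ?M. norm (f (of_real (r n) * cis x) $ k) \<le> C" for n
    using r [of n] by (intro AE_I2 bddk) (simp add: norm_mult)
  show "integrable ?M (\<lambda>x. radial_limit f (cis x) $ k)"
    by (rule integrable_dominated_convergence [OF l_meas s_meas w lim bound])
  have "(\<lambda>n. integral\<^sup>L ?M (\<lambda>x. f (of_real (r n) * cis x) $ k)) \<longlonglongrightarrow> integral\<^sup>L ?M (\<lambda>x. radial_limit f (cis x) $ k)"
    by (rule integral_dominated_convergence [OF l_meas s_meas w lim bound])
  moreover have "integral\<^sup>L ?M (\<lambda>x. f (of_real (r n) * cis x) $ k) = 2 * pi * f 0 $ k" for n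
    by (rule holomorphic_mean_value [OF holk r])
  ultimately show "integral\<^sup>L ?M (\<lambda>x. radial_limit f (cis x) $ k) = 2 * pi * f 0 $ k"
    by (simp add: LIMSEQ_const_iff)
qed

text \<open>\<open>leaf_center\<close> is a bare \<open>lim\<close>, so convergence has to be
  proved. Weak convergence is tested on real and imaginary parts of the coordinates, which are
  admissible since every continuous test function is; their integrals are those of
  \<open>L j 0\<close>.\<close>

lemma leaf_center_limit:
  fixes L :: "nat \<Rightarrow> complex \<Rightarrow> complex^'n"
  assumes "leaf L"
  shows "(\<lambda>j. L j 0) \<longlonglongrightarrow> leaf_center L"
proof -
  have hol: "holomorphic_map (L j)" for j
    using assms by (simp add: leaf_def)
  obtain C where "\<forall>j. \<forall>z\<in>ball 0 1. norm (L j z) \<le> C"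
    using assms unfolding leaf_def by blast
  then have bdd: "norm (L j z) \<le> C" if "z \<in> ball 0 1" for j z
    using that by blast
  have weak: "converge_weakly (\<lambda>j. holomorphic_measure (L j))"
    using assms by (simp add: leaf_def)
  obtain \<nu> where \<nu>: "\<And>\<phi> :: complex^'n \<Rightarrow> real. continuous_on UNIV \<phi> \<Longrightarrow>
      (\<lambda>j. integral\<^sup>L (holomorphic_measure (L j)) \<phi>) \<longlonglongrightarrow> integral\<^sup>L \<nu> \<phi>"
    using weak unfolding converge_weakly_def by blast
  have Re: "integral\<^sup>L (holomorphic_measure (L j)) (\<lambda>z. Re (z $ k)) = Re (L j 0 $ k)"
    and Im: "integral\<^sup>L (holomorphic_measure (L j)) (\<lambda>z. Im (z $ k)) = Im (L j 0 $ k)" for j k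
  proof -
    note rl = integral_radial_limit [OF hol bdd, of j k]
    have m: "(\<lambda>z::complex^'n. Re (z $ k)) \<in> borel_measurable borel" "(\<lambda>z::complex^'n. Im (z $ k)) \<in> borel_measurable borel"
      by (intro borel_measurable_continuous_onI continuous_intros)+
    show "integral\<^sup>L (holomorphic_measure (L j)) (\<lambda>z. Re (z $ k)) = Re (L j 0 $ k)"
      using integral_holomorphic_measure [OF hol m(1)] integral_Re [OF rl(1)] rl(2) by simp
    show "integral\<^sup>L (holomorphic_measure (L j)) (\<lambda>z. Im (z $ k)) = Im (L j 0 $ k)"
      using integral_holomorphic_measure [OF hol m(2)] integral_Im [OF rl(1)] rl(2) by simp
  qed
  define c where "c = (\<chi> k. Complex (integral\<^sup>L \<nu> (\<lambda>z. Re (z $ k))) (integral\<^sup>L \<nu> (\<lambda>z. Im (z $ k))))"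
  have "(\<lambda>j. L j 0) \<longlonglongrightarrow> c"
  proof (rule vec_tendstoI)
    fix k
    have "(\<lambda>j. Re (L j 0 $ k)) \<longlonglongrightarrow> integral\<^sup>L \<nu> (\<lambda>z. Re (z $ k))"
      unfolding Re [symmetric] by (intro \<nu> continuous_intros)
    moreover have "(\<lambda>j. Im (L j 0 $ k)) \<longlonglongrightarrow> integral\<^sup>L \<nu> (\<lambda>z. Im (z $ k))"
      unfolding Im [symmetric] by (intro \<nu> continuous_intros)
    ultimately show "(\<lambda>j. L j 0 $ k) \<longlonglongrightarrow> c $ k"
      by (simp add: c_def tendsto_complex_iff)
  qed
  then show ?thesis unfolding leaf_center_def by (simp add: limI)
qed

section \<open>Limits of leaves\<close>

text \<open>Values outside \<open>V\<close> for infinitely many \<open>j\<close> would, by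
  boundedness, accumulate at a point of the cluster that lies in the closed complement of
  \<open>V\<close>.\<close>

lemma leaf_eventually_in_neighbourhood:
  fixes L :: "nat \<Rightarrow> complex \<Rightarrow> complex^'n"
  assumes bdd: "\<And>j \<zeta>. \<zeta> \<in> ball 0 1 \<Longrightarrow> norm (L j \<zeta>) \<le> C"
    and V: "open V" "leaf_cluster L \<subseteq> V"
  shows "\<forall>\<^sub>F j in sequentially. L j ` ball 0 1 \<subseteq> V"
proof (rule ccontr)
  assume "\<not> ?thesis"
  then have "\<exists>j\<ge>N. \<exists>\<zeta>\<in>ball 0 1. L j \<zeta> \<notin> V" for N
    unfolding eventually_sequentially by blast
  then have "infinite {j. \<exists>\<zeta>\<in>ball 0 1. L j \<zeta> \<notin> V}"
    unfolding infinite_nat_iff_unbounded_le by blast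
  from infinite_enumerate [OF this]
  obtain s where s: "strict_mono (s :: nat \<Rightarrow> nat)" "\<forall>n. s n \<in> {j. \<exists>\<zeta>\<in>ball 0 1. L j \<zeta> \<notin> V}"
    by blast
  then have "\<forall>n. \<exists>\<zeta>. \<zeta> \<in> ball 0 1 \<and> L (s n) \<zeta> \<notin> V" by blast
  then obtain \<zeta> where \<zeta>: "\<And>n. \<zeta> n \<in> ball 0 1" "\<And>n. L (s n) (\<zeta> n) \<notin> V" by metis
  have "bounded (range (\<lambda>n. L (s n) (\<zeta> n)))"
    using bdd \<zeta>(1) by (auto simp: bounded_iff)
  then obtain z r where r: "strict_mono (r :: nat \<Rightarrow> nat)" "((\<lambda>n. L (s n) (\<zeta> n)) \<circ> r) \<longlonglongrightarrow> z"
    using bounded_imp_convergent_subsequence by blast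
  then have "z \<in> leaf_cluster L"
    unfolding leaf_cluster_def using s(1) \<zeta>(1)
    by (auto intro!: exI [of _ "s \<circ> r"] exI [of _ "\<zeta> \<circ> r"] strict_mono_o simp: o_def)
  moreover have "z \<in> - V"
    by (rule closed_sequentially [OF _ _ r(2)]) (use V(1) \<zeta>(2) in auto)
  ultimately show False using V(2) by auto
qed

text \<open>Montel's theorem is applied to one coordinate after another, refining the subsequence
  each time. Convergence of the derivatives at 0 is recorded because the lower bound for the limit
  map rests on it.\<close>

lemma montel_map:
  fixes F :: "nat \<Rightarrow> complex \<Rightarrow> complex^'n"
  assumes hol: "\<And>n. holomorphic_map (F n)"
    and bdd: "\<And>n z. z \<in> ball 0 1 \<Longrightarrow> norm (F n z) \<le> C"
  obtains g r where "holomorphic_map g" "strict_mono (r :: nat \<Rightarrow> nat)"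
    "\<And>z. z \<in> ball 0 1 \<Longrightarrow> (\<lambda>n. F (r n) z) \<longlonglongrightarrow> g z"
    "\<And>k. (\<lambda>n. deriv (\<lambda>z. F (r n) z $ k) 0) \<longlonglongrightarrow> deriv (\<lambda>z. g z $ k) 0"
proof -
  define conv where "conv r G k \<longleftrightarrow> G holomorphic_on ball 0 1 \<and>
    (\<forall>z\<in>ball 0 1. (\<lambda>n. F (r n) z $ k) \<longlonglongrightarrow> G z) \<and> (\<lambda>n. deriv (\<lambda>z. F (r n) z $ k) 0) \<longlonglongrightarrow> deriv G 0"
    for r :: "nat \<Rightarrow> nat" and G k
  \<comment> \<open>Coordinates already treated keep their limits under refinement, which makes the
    induction over the finite index set work.\<close>
  have conv_sub: "conv (r \<circ> q) G k" if "conv r G k" "strict_mono q" for r q G k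
  proof -
    have *: "(\<lambda>n. X (q n)) \<longlonglongrightarrow> a" if "X \<longlonglongrightarrow> a" for X :: "nat \<Rightarrow> complex" and a
      using LIMSEQ_subseq_LIMSEQ [OF that \<open>strict_mono q\<close>] by (simp add: o_def)
    show ?thesis
      using \<open>conv r G k\<close> *  [of "\<lambda>n. F (r n) _ $ k"] * [of "\<lambda>n. deriv (\<lambda>z. F (r n) z $ k) 0"]
      unfolding conv_def o_def by blast
  qed
  have "\<exists>r. strict_mono (r :: nat \<Rightarrow> nat) \<and> (\<forall>k\<in>A. \<exists>G. conv r G k)" if "finite A" for A
    using that
  proof (induction A rule: finite_induct)
    case empty
    show ?case by (intro exI [of _ id]) (simp add: strict_mono_def)
  next
    case (insert k A)
    then obtain r where r: "strict_mono (r :: nat \<Rightarrow> nat)" "\<And>k. k \<in> A \<Longrightarrow> \<exists>G. conv r G k" by auto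
    define H where "H = {h. h holomorphic_on ball 0 1 \<and> (\<forall>z\<in>ball 0 1. cmod (h z) \<le> C)}"
    have FH: "(\<lambda>z. F (r n) z $ k) \<in> H" for n
    proof -
      have "cmod (F (r n) z $ k) \<le> C" if "z \<in> ball 0 1" for z
        using Finite_Cartesian_Product.norm_nth_le [of "F (r n) z" k] bdd [OF that] by (rule order_trans)
      then show ?thesis using hol unfolding H_def holomorphic_map_def by blast
    qed
    obtain G q where G: "G holomorphic_on ball 0 1" "strict_mono (q :: nat \<Rightarrow> nat)"
      "\<And>z. z \<in> ball 0 1 \<Longrightarrow> (\<lambda>n. F (r (q n)) z $ k) \<longlonglongrightarrow> G z"
      "\<And>K. \<lbrakk>compact K; K \<subseteq> ball 0 1\<rbrakk> \<Longrightarrow> uniform_limit K ((\<lambda>n z. F (r n) z $ k) \<circ> q) G sequentially"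
    proof (rule Montel [of "ball 0 1" H "\<lambda>n z. F (r n) z $ k"])
      show "\<exists>B. \<forall>h\<in>H. \<forall>z\<in>K. cmod (h z) \<le> B" if "K \<subseteq> ball 0 1" for K
        using that by (intro exI [of _ C]) (auto simp: H_def)
    qed (use FH in \<open>auto simp: H_def\<close>)
    have "(\<lambda>n. deriv (((\<lambda>n z. F (r n) z $ k) \<circ> q) n) 0) \<longlonglongrightarrow> deriv G 0"
    proof (rule deriv_complex_uniform_limit)
      have sub: "cball 0 (1/2) \<subseteq> ball (0::complex) 1" by auto
      show "uniform_limit (ball 0 (1/2)) ((\<lambda>n z. F (r n) z $ k) \<circ> q) G sequentially"
        using G(4) [OF _ sub] by (intro uniform_limit_on_subset [OF _ ball_subset_cball]) auto
      show "\<forall>\<^sub>F n in sequentially. ((\<lambda>n z. F (r n) z $ k) \<circ> q) n holomorphic_on ball 0 (1/2)"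
      proof (intro always_eventually allI)
        fix n
        have "(\<lambda>z. F (r (q n)) z $ k) holomorphic_on ball 0 1" using FH by (simp add: H_def)
        then show "((\<lambda>n z. F (r n) z $ k) \<circ> q) n holomorphic_on ball 0 (1/2)"
          by (auto simp: o_def intro: holomorphic_on_subset)
      qed
    qed auto
    then have "conv (r \<circ> q) G k" using G by (simp add: conv_def o_def)
    then have "\<forall>k\<in>insert k A. \<exists>G. conv (r \<circ> q) G k" using r(2) conv_sub [OF _ G(2)] by blast
    then show ?case using strict_mono_o [OF r(1) G(2)] by blast
  qed
  from this [of "UNIV :: 'n set"]
  obtain r where r: "strict_mono (r :: nat \<Rightarrow> nat)" "\<And>k. \<exists>G. conv r G k" by auto
  then obtain G where G: "\<And>k. conv r (G k) k" by metis
  show ?thesis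
  proof (rule that [of "\<lambda>z. \<chi> k. G k z" r])
    show "holomorphic_map (\<lambda>z. \<chi> k. G k z)" using G by (simp add: holomorphic_map_def conv_def)
    show "(\<lambda>n. F (r n) z) \<longlonglongrightarrow> (\<chi> k. G k z)" if "z \<in> ball 0 1" for z
      using G that by (intro vec_tendstoI) (simp add: conv_def)
    show "(\<lambda>n. deriv (\<lambda>z. F (r n) z $ k) 0) \<longlonglongrightarrow> deriv (\<lambda>z. (\<chi> k. G k z) $ k) 0" for k
      using G by (simp add: conv_def)
  qed (rule r(1))
qed

section \<open>Chain rule in several variables and automorphisms of the disc\<close>

lemma bounded_linear_axis: "bounded_linear (axis k :: complex \<Rightarrow> complex^'n)"
  unfolding linear_conv_bounded_linear [symmetric]
  by (rule linearI) (simp_all add: vec_eq_iff axis_def)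

text \<open>\<open>multi_holomorphic_on\<close> only provides some coefficient vector
  \<open>c\<close>. Restricting the derivative to the coordinate axes identifies \<open>c\<close>
  with \<open>complex_gradient\<close>, the vector for which a bound is assumed in the
  theorem.\<close>

lemma multi_holomorphic_chain:
  fixes h :: "complex^'n \<Rightarrow> complex"
  assumes h: "multi_holomorphic_on h V" and f: "holomorphic_map f" and fV: "f z \<in> V" and z: "z \<in> ball 0 1"
  shows "((\<lambda>\<zeta>. h (f \<zeta>)) has_field_derivative
    (\<Sum>k\<in>UNIV. complex_gradient h (f z) $ k * deriv (\<lambda>\<zeta>. f \<zeta> $ k) z)) (at z)"
proof -
  obtain c :: "complex^'n" where c: "(h has_derivative (\<lambda>v. \<Sum>k\<in>UNIV. c $ k * v $ k)) (at (f z))"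
    using h fV by (auto simp: multi_holomorphic_on_def)
  have grad: "complex_gradient h (f z) $ k = c $ k" for k
  proof -
    have ax: "((\<lambda>w. f z + axis k w) has_derivative axis k) (at 0)"
      using has_derivative_add [OF has_derivative_const bounded_linear_imp_has_derivative [OF bounded_linear_axis]]
      by simp
    have "axis k 0 = (0 :: complex^'n)" by (simp add: vec_eq_iff axis_def)
    then have "(h has_derivative (\<lambda>v. \<Sum>k\<in>UNIV. c $ k * v $ k)) (at (f z + axis k 0))"
      using c by (simp only: add_0_right)
    from has_derivative_compose [OF ax this]
    have "((\<lambda>w. h (f z + axis k w)) has_derivative (\<lambda>w. \<Sum>i\<in>UNIV. c $ i * axis k w $ i)) (at 0)" .
    moreover have "(\<Sum>i\<in>UNIV. c $ i * axis k w $ i) = c $ k * w" for w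
      by (simp add: axis_def if_distrib cong: if_cong)
    ultimately have "((\<lambda>w. h (f z + axis k w)) has_field_derivative c $ k) (at 0)"
      by (simp add: has_field_derivative_def)
    then show ?thesis by (simp add: complex_gradient_def DERIV_imp_deriv)
  qed
  define d where "d k = deriv (\<lambda>\<zeta>. f \<zeta> $ k) z" for k
  \<comment> \<open>Writing a vector through its coordinates assembles the derivative of
    \<open>f\<close> from the derivatives of its components.\<close>
  have expand: "v = (\<Sum>k\<in>UNIV. axis k (v $ k))" for v :: "complex^'n"
    by (simp add: vec_eq_iff axis_def)
  have "((\<lambda>\<zeta>. \<Sum>k\<in>UNIV. axis k (f \<zeta> $ k)) has_derivative (\<lambda>w. \<Sum>k\<in>UNIV. axis k (d k * w))) (at z)"
  proof (intro has_derivative_sum bounded_linear.has_derivative [OF bounded_linear_axis])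
    fix k
    have "(\<lambda>\<zeta>. f \<zeta> $ k) holomorphic_on ball 0 1" using f by (simp add: holomorphic_map_def)
    then have "((\<lambda>\<zeta>. f \<zeta> $ k) has_field_derivative d k) (at z)"
      unfolding d_def by (rule holomorphic_derivI) (use z in auto)
    then show "((\<lambda>\<zeta>. f \<zeta> $ k) has_derivative (\<lambda>w. d k * w)) (at z)"
      by (simp add: has_field_derivative_def)
  qed
  then have "(f has_derivative (\<lambda>w. \<Sum>k\<in>UNIV. axis k (d k * w))) (at z)"
    by (simp flip: expand)
  from has_derivative_compose [OF this c]
  have "((\<lambda>\<zeta>. h (f \<zeta>)) has_derivative (\<lambda>w. \<Sum>k\<in>UNIV. c $ k * (\<Sum>i\<in>UNIV. axis i (d i * w)) $ k)) (at z)" .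
  moreover have "(\<Sum>k\<in>UNIV. c $ k * (\<Sum>i\<in>UNIV. axis i (d i * w)) $ k) = (\<Sum>k\<in>UNIV. c $ k * d k) * w" for w
    by (simp add: axis_def sum_distrib_right mult.assoc)
  ultimately show ?thesis
    by (simp add: has_field_derivative_def grad d_def)
qed

text \<open>The derivative \<open>1 - |w|^2\<close> at 0 is the point: composition with \<mu> turns
  the weighted derivative at \<open>w\<close> into an ordinary derivative at 0.\<close>

lemma disc_automorphism:
  assumes w: "cmod w < 1"
  obtains \<mu> where "\<mu> holomorphic_on ball 0 1" "\<And>z. z \<in> ball 0 1 \<Longrightarrow> \<mu> z \<in> ball 0 1" "\<mu> 0 = w"
    "(\<mu> has_field_derivative of_real (1 - (cmod w)\<^sup>2)) (at 0)"
proof (rule that [of "Moebius_function 0 (- w)"])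
  show "Moebius_function 0 (- w) holomorphic_on ball 0 1"
    using w by (intro Moebius_function_holomorphic) simp
  show "Moebius_function 0 (- w) z \<in> ball 0 1" if "z \<in> ball 0 1" for z
    using Moebius_function_norm_lt_1 [of "- w" z] w that by simp
  have "((\<lambda>z. (z + w) / (1 + cnj w * z)) has_field_derivative (1 - w * cnj w)) (at 0)"
    by (auto intro!: derivative_eq_intros)
  also have "1 - w * cnj w = of_real (1 - (cmod w)\<^sup>2)"
    by (simp only: of_real_diff of_real_1 complex_norm_square)
  finally show "(Moebius_function 0 (- w) has_field_derivative of_real (1 - (cmod w)\<^sup>2)) (at 0)"
    by (simp add: Moebius_function_def [abs_def])
qed (simp add: Moebius_function_def)

text \<open>The radius is chosen before \<open>L\<close>, \<open>h\<close> and \<open>V\<close>,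
  which expresses that it is determined by \<open>M\<close>, \<open>b\<close>, \<alpha> and the
  dimension \<open>CARD('n)\<close>.\<close>

theorem theorem4p1:
  fixes M b \<alpha> :: real
  assumes "b < 1" and "0 < \<alpha>"
  shows "\<exists>r>0. \<forall>(L :: nat \<Rightarrow> complex \<Rightarrow> complex^'n) (h :: complex^'n \<Rightarrow> complex) V.
    leaf L \<longrightarrow>
    open V \<longrightarrow> leaf_cluster L \<subseteq> V \<longrightarrow> multi_holomorphic_on h V \<longrightarrow>
    (\<forall>z\<in>V. norm (h z) < M \<and> norm (complex_gradient h z) < M) \<longrightarrow>
    norm (h (leaf_center L)) \<le> b \<longrightarrow>
    (\<forall>j. \<exists>\<gamma> l. circle_arc \<gamma> l \<and> \<alpha> < l \<and>
       (\<forall>\<zeta>\<in>\<gamma>. 1 \<le> Liminf (at_left 1) (\<lambda>t. ereal (norm (h (L j (of_real t * \<zeta>))))))) \<longrightarrow>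
    (\<exists>g :: complex \<Rightarrow> complex^'n.
       holomorphic_map g \<and> \<not> g constant_on ball 0 1 \<and>
       g ` ball 0 1 \<subseteq> leaf_cluster L \<and>
       (\<exists>k a. covers_univalently (\<lambda>\<zeta>. g \<zeta> $ k) (ball a r)))"
proof -
  \<comment> \<open>\<open>arc_forces_large_derivative\<close> wants a bound at least 1 and a
    central value between 1/2 and 1. The midpoint \<open>b1\<close> also lies strictly above
    \<open>b\<close>, which leaves room for \<open>h (L j 0)\<close> to be merely close to its
    limit.\<close>
  define M' where "M' = max M 1"
  define b1 where "b1 = (1 + max b 0) / 2"
  have M': "1 \<le> M'" "M \<le> M'" by (auto simp: M'_def)
  have b1: "1/2 \<le> b1" "b1 < 1" "b < b1" using assms(1) by (auto simp: b1_def max_def)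
  define \<delta> where "\<delta> = min ((1 - b1)\<^sup>2 / (30000 * M')) ((1 - b1) * (1 - exp (- \<alpha> / 2)) / 10)"
  have \<delta>: "0 < \<delta>" using M' b1 assms(2) by (simp add: \<delta>_def)
  have "\<delta> \<le> (1 - b1)\<^sup>2 / (30000 * M')" "\<delta> \<le> (1 - b1) * (1 - exp (- \<alpha> / 2)) / 10"
    unfolding \<delta>_def by (rule min.cobounded1, rule min.cobounded2)
  then have \<delta>_le: "30000 * M' * \<delta> \<le> (1 - b1)\<^sup>2" "10 * \<delta> \<le> (1 - b1) * (1 - exp (- \<alpha> / 2))"
    using M' by (simp_all add: pos_le_divide_eq mult_ac)
  \<comment> \<open>If all \<open>n\<close> coordinates had derivative below \<kappa> at 0, the
    chain rule with gradient bound \<open>M'\<close> would give less than \<delta>.\<close>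
  define \<kappa> where "\<kappa> = \<delta> / (M' * CARD('n))"
  have \<kappa>: "0 < \<kappa>" using \<delta> M' by (simp add: \<kappa>_def)
  show ?thesis
  proof (intro exI [of _ "\<kappa> / 128"] conjI allI impI)
    show "0 < \<kappa> / 128" using \<kappa> by simp
    fix L :: "nat \<Rightarrow> complex \<Rightarrow> complex^'n" and h :: "complex^'n \<Rightarrow> complex" and V
    assume leaf: "leaf L" and V: "open V" "leaf_cluster L \<subseteq> V" and h: "multi_holomorphic_on h V"
      and hM: "\<forall>z\<in>V. norm (h z) < M \<and> norm (complex_gradient h z) < M"
      and center: "norm (h (leaf_center L)) \<le> b"
      and arcs: "\<forall>j. \<exists>\<gamma> l. circle_arc \<gamma> l \<and> \<alpha> < l \<and>
       (\<forall>\<zeta>\<in>\<gamma>. 1 \<le> Liminf (at_left 1) (\<lambda>t. ereal (norm (h (L j (of_real t * \<zeta>))))))"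
    have holL: "holomorphic_map (L j)" for j using leaf by (simp add: leaf_def)
    obtain C where C: "\<And>j z. z \<in> ball 0 1 \<Longrightarrow> norm (L j z) \<le> C"
      using leaf unfolding leaf_def by blast
    have lim0: "(\<lambda>j. L j 0) \<longlonglongrightarrow> leaf_center L" by (rule leaf_center_limit [OF leaf])
    have "leaf_center L \<in> leaf_cluster L"
      unfolding leaf_cluster_def
      by (intro CollectI exI [of _ id] exI [of _ "\<lambda>_. 0"]) (simp add: lim0 strict_mono_def)
    then have "isCont h (leaf_center L)"
      using h V(2) unfolding multi_holomorphic_on_def by (blast intro: has_derivative_continuous)
    then have "(\<lambda>j. cmod (h (L j 0))) \<longlonglongrightarrow> cmod (h (leaf_center L))"
      by (intro tendsto_norm isCont_tendsto_compose [OF _ lim0])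
    then have "\<forall>\<^sub>F j in sequentially. cmod (h (L j 0)) < b1"
      by (rule order_tendstoD) (use center b1 in simp)
    moreover have "\<forall>\<^sub>F j in sequentially. L j ` ball 0 1 \<subseteq> V"
      by (rule leaf_eventually_in_neighbourhood [OF C V])
    ultimately have "\<forall>\<^sub>F j in sequentially. cmod (h (L j 0)) < b1 \<and> L j ` ball 0 1 \<subseteq> V"
      by (rule eventually_conj)
    \<comment> \<open>Below \<open>J\<close> the map \<open>L j\<close> may leave \<open>V\<close>,
      where nothing is known about \<open>h\<close>; hence the shifted index \<open>n + J\<close>
      from here on.\<close>
    then obtain J where J: "\<And>j. J \<le> j \<Longrightarrow> cmod (h (L j 0)) < b1 \<and> L j ` ball 0 1 \<subseteq> V"
      unfolding eventually_sequentially by blast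
    have inV: "L j z \<in> V" if "J \<le> j" "z \<in> ball 0 1" for j z
      using J [OF that(1)] that(2) by blast
    have hL: "(\<lambda>z. h (L j z)) holomorphic_on ball 0 1" if "J \<le> j" for j
      using multi_holomorphic_chain [OF h holL inV [OF that]] unfolding holomorphic_on_open [OF open_ball] by blast
    have "\<exists>z. cmod z < 1 \<and> \<delta> < (1 - (cmod z)\<^sup>2) * cmod (deriv (\<lambda>z. h (L j z)) z)" if "J \<le> j" for j
    proof -
      obtain \<gamma> l where arc: "circle_arc \<gamma> l" "\<alpha> < l"
        "\<And>\<zeta>. \<zeta> \<in> \<gamma> \<Longrightarrow> 1 \<le> Liminf (at_left 1) (\<lambda>t. ereal (cmod (h (L j (of_real t * \<zeta>)))))"
        using arcs by blast
      show ?thesis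
      proof (rule arc_forces_large_derivative [OF hL [OF that] _ M'(1) _ b1(1,2) arc(1,2) assms(2) arc(3) \<delta> \<delta>_le])
        show "cmod (h (L j z)) \<le> M'" if "cmod z < 1" for z
          using hM inV [OF \<open>J \<le> j\<close>, of z] that M'(2) by force
        show "cmod (h (L j 0)) \<le> b1" using J [OF that] by simp
      qed
    qed
    then have "\<exists>z. cmod z < 1 \<and> \<delta> < (1 - (cmod z)\<^sup>2) * cmod (deriv (\<lambda>z. h (L (n + J) z)) z)" for n
      by simp
    then obtain w where w: "\<And>n. cmod (w n) < 1"
      "\<And>n. \<delta> < (1 - (cmod (w n))\<^sup>2) * cmod (deriv (\<lambda>z. h (L (n + J) z)) (w n))"
      by metis
    have "\<exists>\<mu>. \<mu> holomorphic_on ball 0 1 \<and> (\<forall>z\<in>ball 0 1. \<mu> z \<in> ball 0 1) \<and> \<mu> 0 = w n \<and>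
      (\<mu> has_field_derivative of_real (1 - (cmod (w n))\<^sup>2)) (at 0)" for n
      using disc_automorphism [OF w(1) [of n]] by metis
    then obtain \<mu> where \<mu>: "\<And>n. \<mu> n holomorphic_on ball 0 1" "\<And>n z. z \<in> ball 0 1 \<Longrightarrow> \<mu> n z \<in> ball 0 1"
      "\<And>n. \<mu> n 0 = w n" "\<And>n. (\<mu> n has_field_derivative of_real (1 - (cmod (w n))\<^sup>2)) (at 0)"
      by metis
    define F where "F n z = L (n + J) (\<mu> n z)" for n z
    have holF: "holomorphic_map (F n)" for n
      unfolding holomorphic_map_def
    proof
      fix k
      have "(\<lambda>\<zeta>. L (n + J) \<zeta> $ k) holomorphic_on ball 0 1" using holL by (simp add: holomorphic_map_def)
      moreover have "\<mu> n ` ball 0 1 \<subseteq> ball 0 1" using \<mu>(2) by blast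
      ultimately show "(\<lambda>\<zeta>. F n \<zeta> $ k) holomorphic_on ball 0 1"
        using holomorphic_on_compose_gen [OF \<mu>(1)] by (simp add: F_def o_def)
    qed
    have FV: "F n z \<in> V" if "z \<in> ball 0 1" for n z
      unfolding F_def using \<mu>(2) that by (intro inV) auto
    obtain g r where g: "holomorphic_map g" "strict_mono (r :: nat \<Rightarrow> nat)"
      "\<And>z. z \<in> ball 0 1 \<Longrightarrow> (\<lambda>n. F (r n) z) \<longlonglongrightarrow> g z"
      "\<And>k. (\<lambda>n. deriv (\<lambda>z. F (r n) z $ k) 0) \<longlonglongrightarrow> deriv (\<lambda>z. g z $ k) 0"
    proof (rule montel_map [of F C])
      show "holomorphic_map (F n)" for n by (rule holF)
      show "norm (F n z) \<le> C" if "z \<in> ball 0 1" for n z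
        unfolding F_def using \<mu>(2) [OF that] by (rule C)
    qed blast
    \<comment> \<open>The derivative of \<open>h (F n z)\<close> at 0 exceeds \<delta> in modulus.
      Stated through the coordinates of \<open>F n\<close>, the bound passes to the limit term by
      term.\<close>
    have large: "\<delta> \<le> M' * (\<Sum>k\<in>UNIV. cmod (deriv (\<lambda>z. F n z $ k) 0))" for n
    proof -
      have F0: "F n 0 \<in> V" by (rule FV) simp
      have "((\<lambda>z. h (L (n + J) z)) has_field_derivative deriv (\<lambda>z. h (L (n + J) z)) (w n)) (at (\<mu> n 0))"
        using w(1) \<mu>(3) by (simp add: holomorphic_derivI [OF hL open_ball])
      from DERIV_chain2 [OF this \<mu>(4)]
      have "((\<lambda>z. h (F n z)) has_field_derivative
        deriv (\<lambda>z. h (L (n + J) z)) (w n) * of_real (1 - (cmod (w n))\<^sup>2)) (at 0)"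
        by (simp add: F_def)
      from DERIV_unique [OF this multi_holomorphic_chain [OF h holF F0]]
      have eq: "deriv (\<lambda>z. h (L (n + J) z)) (w n) * of_real (1 - (cmod (w n))\<^sup>2) =
        (\<Sum>k\<in>UNIV. complex_gradient h (F n 0) $ k * deriv (\<lambda>z. F n z $ k) 0)" by simp
      have "(cmod (w n))\<^sup>2 \<le> 1" using w(1) [of n] by (simp add: abs_square_le_1)
      then have "\<delta> < cmod (deriv (\<lambda>z. h (L (n + J) z)) (w n) * of_real (1 - (cmod (w n))\<^sup>2))"
        using w(2) [of n] by (simp add: norm_mult mult.commute del: of_real_diff)
      also have "\<dots> \<le> (\<Sum>k\<in>UNIV. cmod (complex_gradient h (F n 0) $ k * deriv (\<lambda>z. F n z $ k) 0))"
        unfolding eq by (rule norm_sum)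
      also have "\<dots> \<le> (\<Sum>k\<in>UNIV. M' * cmod (deriv (\<lambda>z. F n z $ k) 0))"
      proof (rule sum_mono)
        fix k
        have "cmod (complex_gradient h (F n 0) $ k) \<le> norm (complex_gradient h (F n 0))"
          by (rule Finite_Cartesian_Product.norm_nth_le)
        also have "\<dots> \<le> M'" using hM F0 M'(2) by force
        finally show "cmod (complex_gradient h (F n 0) $ k * deriv (\<lambda>z. F n z $ k) 0) \<le> M' * cmod (deriv (\<lambda>z. F n z $ k) 0)"
          unfolding norm_mult by (intro mult_right_mono) auto
      qed
      finally show ?thesis by (simp add: sum_distrib_left)
    qed
    have large_g: "\<delta> \<le> M' * (\<Sum>k\<in>UNIV. cmod (deriv (\<lambda>z. g z $ k) 0))"
    proof (rule tendsto_lowerbound)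
      show "(\<lambda>n. M' * (\<Sum>k\<in>UNIV. cmod (deriv (\<lambda>z. F (r n) z $ k) 0))) \<longlonglongrightarrow> M' * (\<Sum>k\<in>UNIV. cmod (deriv (\<lambda>z. g z $ k) 0))"
        by (intro tendsto_intros g)
    qed (use large in auto)
    have "\<exists>k. \<kappa> \<le> cmod (deriv (\<lambda>z. g z $ k) 0)"
    proof (rule ccontr)
      assume "\<not> ?thesis"
      then have "(\<Sum>k\<in>UNIV. cmod (deriv (\<lambda>z. g z $ k) 0)) < (\<Sum>k\<in>(UNIV :: 'n set). \<kappa>)"
        by (intro sum_strict_mono) (auto simp: not_le)
      then have "M' * (\<Sum>k\<in>UNIV. cmod (deriv (\<lambda>z. g z $ k) 0)) < M' * (CARD('n) * \<kappa>)"
        using M' by simp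
      also have "\<dots> = \<delta>" using M' by (simp add: \<kappa>_def)
      finally show False using large_g by simp
    qed
    then obtain k where k: "\<kappa> \<le> cmod (deriv (\<lambda>z. g z $ k) 0)" by blast
    have holgk: "(\<lambda>z. g z $ k) holomorphic_on ball 0 1" using g(1) by (simp add: holomorphic_map_def)
    have "\<exists>a. covers_univalently (\<lambda>z. g z $ k) (ball a (\<kappa> / 128))"
      by (rule univalent_bloch [OF holgk \<kappa> k])
    moreover have "\<not> g constant_on ball 0 1"
    proof
      assume "g constant_on ball 0 1"
      then obtain c where c: "\<And>z. z \<in> ball 0 1 \<Longrightarrow> g z = c" by (auto simp: constant_on_def)
      have "((\<lambda>z. g z $ k) has_field_derivative 0) (at 0)"
        by (rule has_field_derivative_transform_within_open [OF DERIV_const [of "c $ k"] open_ball [of 0 1]]) (simp_all add: c)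
      then show False using k \<kappa> by (simp add: DERIV_imp_deriv)
    qed
    \<comment> \<open>The points \<mu> \<open>(r n) z\<close> depend on \<open>n\<close> and may
      approach the circle; the definition of the cluster allows this.\<close>
    moreover have "g ` ball 0 1 \<subseteq> leaf_cluster L"
    proof
      fix y assume "y \<in> g ` ball 0 1"
      then obtain z where z: "z \<in> ball 0 1" "y = g z" by blast
      have "strict_mono (\<lambda>n. r n + J)" using g(2) by (simp add: strict_mono_def)
      moreover have "(\<lambda>n. L (r n + J) (\<mu> (r n) z)) \<longlonglongrightarrow> y"
        using g(3) [OF z(1)] z(2) by (simp add: F_def)
      ultimately show "y \<in> leaf_cluster L"
        unfolding leaf_cluster_def using \<mu>(2) [OF z(1)]
        by (intro CollectI exI [of _ "\<lambda>n. r n + J"] exI [of _ "\<lambda>n. \<mu> (r n) z"]) simp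
    qed
    ultimately show "\<exists>g :: complex \<Rightarrow> complex^'n.
       holomorphic_map g \<and> \<not> g constant_on ball 0 1 \<and> g ` ball 0 1 \<subseteq> leaf_cluster L \<and>
       (\<exists>k a. covers_univalently (\<lambda>\<zeta>. g \<zeta> $ k) (ball a (\<kappa> / 128)))"
      using g(1) by blast
  qed
qed

end
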